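(* Let $S(z,\mathbf t)$ be a solution of the dispersionless BKP hierarchy with $\tau$-function $F(\mathbf t)$, $\mathbf t=(t_1,t_3,t_5,\dots)$, and put $x=t_1$, $y=t_3$, $p(z)=\partial_xS(z)$, $u=-\partial_x\widetilde S_1$. Let $\zeta_1,\dots,\zeta_N$ and $\tilde\zeta_1,\dots,\tilde\zeta_N$ be points of $\mathbb C$, $c_1,\dots,c_N$ constants, $p_i=p(\zeta_i)$, $\tilde p_i=p(\tilde\zeta_i)$, and impose the symmetry constraint $$F_x=\frac12\sum_{i=1}^Nc_i\bigl(S(\zeta_i)-S(\tilde\zeta_i)\bigr).$$ Then: (a) in terms of $u$ the constraint reads $u=\sum_{i=1}^Nc_i(p_i-\tilde p_i)$; (b) the first hydrodynamic type system of the constrained hierarchy is, for $k=1,\dots,N$, $$\partial_yp_k=\partial_x\Bigl(p_k^3+3p_k\sum_{i}c_i(p_i-\tilde p_i)\Bigr),\qquad \partial_y\tilde p_k=\partial_x\Bigl(\tilde p_k^3+3\tilde p_k\sum_{i}c_i(p_i-\tilde p_i)\Bigr);$$ (c) the Sato function $z(p)$ of the constrained hierarchy, relating $z$ and $p=p(z)$, is $$z=p-\frac12\sum_{i=1}^Nc_i\ln\left(\frac{p-p_i}{p+p_i}\cdot\frac{p+\tilde p_i}{p-\tilde p_i}\right);$$ (d) the generating equation for the constrained hierarchy is $$\mathcal D(z)p_k=-\frac12\,\partial_x\ln\left(\frac{p-p_k}{p+p_k}\cdot\frac{p+\tilde p_k}{p-\tilde p_k}\right),$$ where $p$ is the function of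 $z$ and of $p_1,\dots,p_N,\tilde p_1,\dots,\tilde p_N$ defined by the relation in (c).
   Context: The B-type quasiclassical vertex operator is $\mathcal D(z)=2\sum_{n=0}^\infty\frac{z^{-(2n+1)}}{2n+1}\frac{\partial}{\partial t_{2n+1}}$, $|z|>1$. A solution of the dispersionless BKP hierarchy is a function $S=S_0+\widetilde S$ solving a nonlinear Beltrami equation $S_{\bar z}=W(z,\bar z,S_z)$ with $W$ localized in the unit disc and $W(-z,-\bar z,\eta)=W(z,\bar z,\eta)$, where $S_0(z,\mathbf t)=\sum_{n\ge0}t_{2n+1}z^{2n+1}$, $S(-z,\mathbf t)=-S(z,\mathbf t)$, and $\widetilde S$ is analytic in $z$ outside the unit disc with $\widetilde S=\sum_{i\ge1}\widetilde S_i(\mathbf t)z^{-i}$ at infinity. It satisfies, with $p(z)=\partial_{t_1}S(z)$, $$\frac{p(z_1)-p(z)}{p(z_1)+p(z)}=\exp(-\mathcal D(z_1)S(z)),\qquad z\in\mathbb C,\ |z_1|>1,$$ where $\mathcal D(z_1)S_0(z)=\ln\frac{z_1+z}{z_1-z}$. Its $\tau$-function $F(\mathbf t)$ is characterized by $\widetilde S(z,\mathbf t)=-\mathcal D(z)F(\mathbf t)$. The logarithms in the Sato function are the branches vanishing at $p=\infty$.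
   Formalization: Part (d) as printed is false in general (e.g. when the two points coincide); it is corrected to D(z)p_k = -∂_x ln((p-p_k)/(p+p_k)), likewise for p̃_k, and the printed right-hand side is shown to equal D(z)[(p_k - p̃_k)/2]. *)

theory Defs
  imports "HOL-Complex_Analysis.Complex_Analysis"
begin

text \<open>
  The time \<open>t n\<close> stands for $t_{2n+1}$; in particular \<open>x = t 0\<close> and \<open>y = t 1\<close>.
\<close>

type_synonym times = "nat \<Rightarrow> complex"


subsection \<open>Functions of infinitely many times\<close>

text \<open>
  Domains of times and functions on them are understood in the finitely-open sense: only
  finitely many times are varied at once.  (The product topology would be too coarse here: none
  of its nonempty open sets consists of times for which $S_0$ converges.)
\<close>

definition finite_nbhd :: "nat set \<Rightarrow> real \<Rightarrow> times \<Rightarrow> times set" where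
  "finite_nbhd A \<delta> t = {t'. (\<forall>n\<in>A. dist (t' n) (t n) < \<delta>) \<and> (\<forall>n. n \<notin> A \<longrightarrow> t' n = t n)}"

definition finitely_open :: "times set \<Rightarrow> bool" where
  "finitely_open T \<longleftrightarrow> (\<forall>t\<in>T. \<forall>A. finite A \<longrightarrow> (\<exists>\<delta>>0. finite_nbhd A \<delta> t \<subseteq> T))"

text \<open>
  Continuous and separately holomorphic, i.e. (Osgood) jointly holomorphic in any finite set of
  times.
\<close>

definition times_holomorphic :: "times set \<Rightarrow> (times \<Rightarrow> complex) \<Rightarrow> bool" where
  "times_holomorphic T f \<longleftrightarrow>
     (\<forall>t\<in>T. \<forall>n. (\<lambda>s. f (t(n := s))) field_differentiable at (t n)) \<and>
     (\<forall>t\<in>T. \<forall>A. finite A \<longrightarrow>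
        (\<forall>e>0. \<exists>\<delta>>0. \<forall>t' \<in> finite_nbhd A \<delta> t \<inter> T. dist (f t') (f t) < e))"

definition pd :: "nat \<Rightarrow> (times \<Rightarrow> complex) \<Rightarrow> times \<Rightarrow> complex" where
  "pd n f t = deriv (\<lambda>s. f (t(n := s))) (t n)"


subsection \<open>The vertex operator\<close>

definition vertex_term :: "complex \<Rightarrow> (times \<Rightarrow> complex) \<Rightarrow> times \<Rightarrow> nat \<Rightarrow> complex" where
  "vertex_term z f t n = inverse (z ^ (2 * n + 1)) / of_nat (2 * n + 1) * pd n f t"

definition vertex_summable :: "complex \<Rightarrow> (times \<Rightarrow> complex) \<Rightarrow> times \<Rightarrow> bool" where
  "vertex_summable z f t \<longleftrightarrow> summable (vertex_term z f t)"

definition vertex_op :: "complex \<Rightarrow> (times \<Rightarrow> complex) \<Rightarrow> times \<Rightarrow> complex" where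
  "vertex_op z f t = 2 * (\<Sum>n. vertex_term z f t n)"


subsection \<open>Solutions of the dispersionless BKP hierarchy\<close>

definition wirtinger_z :: "(complex \<Rightarrow> complex) \<Rightarrow> complex \<Rightarrow> complex" where
  "wirtinger_z g z = (frechet_derivative g (at z) 1 - \<i> * frechet_derivative g (at z) \<i>) / 2"

definition wirtinger_zbar :: "(complex \<Rightarrow> complex) \<Rightarrow> complex \<Rightarrow> complex" where
  "wirtinger_zbar g z = (frechet_derivative g (at z) 1 + \<i> * frechet_derivative g (at z) \<i>) / 2"

definition S0 :: "complex \<Rightarrow> times \<Rightarrow> complex" where
  "S0 z t = (\<Sum>n. t n * z ^ (2 * n + 1))"

definition S_tilde :: "(complex \<Rightarrow> times \<Rightarrow> complex) \<Rightarrow> complex \<Rightarrow> times \<Rightarrow> complex" where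
  "S_tilde S z t = S z t - S0 z t"

definition momentum :: "(complex \<Rightarrow> times \<Rightarrow> complex) \<Rightarrow> complex \<Rightarrow> times \<Rightarrow> complex" where
  "momentum S z t = pd 0 (S z) t"

text \<open>
  \<open>Sc i\<close> is the coefficient $\widetilde S_i$.  The function \<open>W\<close> may jump across the unit circle, so
  the Beltrami equation is required in the classical sense off the circle and \<open>S\<close> is continuous
  across it.  In \<open>vertex_identity\<close> the series for $\mathcal D(z_1)S_0(z)$, which converges only for
  $|z|<|z_1|$, is replaced by the logarithm it sums to; at $z=\pm z_1$ both sides are singular or
  vanish in the limit, so these points are left out.
\<close>

locale dBKP_solution =
  fixes T :: "times set"
    and W :: "complex \<Rightarrow> complex \<Rightarrow> complex \<Rightarrow> complex"
    and S :: "complex \<Rightarrow> times \<Rightarrow> complex"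
    and Sc :: "nat \<Rightarrow> times \<Rightarrow> complex"
  assumes times_open: "finitely_open T"
    and S0_summable: "\<And>t z. t \<in> T \<Longrightarrow> summable (\<lambda>n. t n * z ^ (2 * n + 1))"
    and S_holomorphic_times: "\<And>z. times_holomorphic T (S z)"
    and S_jointly_continuous:
      "\<And>z t A e. t \<in> T \<Longrightarrow> finite A \<Longrightarrow> 0 < e \<Longrightarrow>
         \<exists>\<delta>>0. \<forall>z' \<in> ball z \<delta>. \<forall>t' \<in> finite_nbhd A \<delta> t \<inter> T. dist (S z' t') (S z t) < e"
    and W_localized: "\<And>z \<eta>. 1 < norm z \<Longrightarrow> W z (cnj z) \<eta> = 0"
    and W_even: "\<And>z \<eta>. W (- z) (- cnj z) \<eta> = W z (cnj z) \<eta>"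
    and S_differentiable:
      "\<And>z t. t \<in> T \<Longrightarrow> norm z \<noteq> 1 \<Longrightarrow> (\<lambda>w. S w t) differentiable (at z)"
    and beltrami:
      "\<And>z t. t \<in> T \<Longrightarrow> norm z \<noteq> 1 \<Longrightarrow>
         wirtinger_zbar (\<lambda>w. S w t) z = W z (cnj z) (wirtinger_z (\<lambda>w. S w t) z)"
    and S_odd: "\<And>z t. t \<in> T \<Longrightarrow> S (- z) t = - S z t"
    and S_tilde_analytic:
      "\<And>t. t \<in> T \<Longrightarrow> (\<lambda>z. S_tilde S z t) analytic_on {z. 1 < norm z}"
    and S_tilde_expansion:
      "\<And>z t. t \<in> T \<Longrightarrow> 1 < norm z \<Longrightarrow>
         (\<lambda>i. Sc (Suc i) t * inverse (z ^ Suc i)) sums S_tilde S z t"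
    and vertex_S_tilde_summable:
      "\<And>z z1 t. t \<in> T \<Longrightarrow> 1 < norm z1 \<Longrightarrow> vertex_summable z1 (S_tilde S z) t"
    and vertex_identity:
      "\<And>z z1 t. t \<in> T \<Longrightarrow> 1 < norm z1 \<Longrightarrow> z \<noteq> z1 \<Longrightarrow> z \<noteq> - z1 \<Longrightarrow>
         (momentum S z1 t - momentum S z t) / (momentum S z1 t + momentum S z t)
           = exp (- (Ln ((z1 + z) / (z1 - z)) + vertex_op z1 (S_tilde S z) t))"

definition tau_function ::
    "times set \<Rightarrow> (complex \<Rightarrow> times \<Rightarrow> complex) \<Rightarrow> (times \<Rightarrow> complex) \<Rightarrow> bool" where
  "tau_function T S F \<longleftrightarrow> times_holomorphic T F \<and>
     (\<forall>t\<in>T. \<forall>z. 1 < norm z \<longrightarrow>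
        vertex_summable z F t \<and> S_tilde S z t = - vertex_op z F t)"


subsection \<open>The Sato function\<close>

text \<open>\<open>log_branch \<Omega> f L\<close>: \<open>L\<close> is the branch of $\ln f$ on \<open>\<Omega>\<close> vanishing at infinity.\<close>

definition log_branch :: "complex set \<Rightarrow> (complex \<Rightarrow> complex) \<Rightarrow> (complex \<Rightarrow> complex) \<Rightarrow> bool" where
  "log_branch \<Omega> f L \<longleftrightarrow>
     open \<Omega> \<and> connected \<Omega> \<and> (\<forall>\<^sub>F q in at_infinity. q \<in> \<Omega>) \<and>
     L holomorphic_on \<Omega> \<and> (\<forall>q\<in>\<Omega>. exp (L q) = f q) \<and> (L \<longlongrightarrow> 0) at_infinity"

definition has_log :: "complex set \<Rightarrow> (complex \<Rightarrow> complex) \<Rightarrow> bool" where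
  "has_log \<Omega> f \<longleftrightarrow> (\<exists>L. log_branch \<Omega> f L)"

text \<open>Meaningful under \<open>has_log \<Omega> f\<close>; the values on \<open>\<Omega>\<close> are then uniquely determined.\<close>

definition log_inf :: "complex set \<Rightarrow> (complex \<Rightarrow> complex) \<Rightarrow> complex \<Rightarrow> complex" where
  "log_inf \<Omega> f = (SOME L. log_branch \<Omega> f L)"

definition ratio1 :: "complex \<Rightarrow> complex \<Rightarrow> complex" where
  "ratio1 a q = (q - a) / (q + a)"

definition ratio2 :: "complex \<Rightarrow> complex \<Rightarrow> complex \<Rightarrow> complex" where
  "ratio2 a b q = (q - a) / (q + a) * ((q + b) / (q - b))"

definition exterior :: "real \<Rightarrow> complex set" where
  "exterior R = {z. R < norm z}"

text \<open>
  The exterior domain on which the logarithms in the Sato function have a branch vanishing at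
  infinity; it is $|z|>1$ if all the points lie in the closed unit disc.
\<close>

definition sato_radius :: "nat \<Rightarrow> (nat \<Rightarrow> complex) \<Rightarrow> (nat \<Rightarrow> complex) \<Rightarrow> real" where
  "sato_radius N \<zeta> \<zeta>' = Max (insert 1 ((\<lambda>i. norm (\<zeta> i)) ` {1..N} \<union> (\<lambda>i. norm (\<zeta>' i)) ` {1..N}))"

text \<open>
  \<open>sato_relation R N c a b P\<close>: on $|z|>R$ the function $p=P(z)$, with $P(\infty)=\infty$, satisfies
  $z=p-\frac12\sum_i c_i\ln\bigl(\frac{p-a_i}{p+a_i}\cdot\frac{p+b_i}{p-b_i}\bigr)$.
  This determines \<open>P\<close> uniquely on $|z|>R$.
\<close>

definition sato_relation ::
    "real \<Rightarrow> nat \<Rightarrow> (nat \<Rightarrow> complex) \<Rightarrow> (nat \<Rightarrow> complex) \<Rightarrow> (nat \<Rightarrow> complex) \<Rightarrow>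
     (complex \<Rightarrow> complex) \<Rightarrow> bool" where
  "sato_relation R N c a b P \<longleftrightarrow>
     P holomorphic_on exterior R \<and> filterlim P at_infinity at_infinity \<and>
     (\<forall>i\<in>{1..N}. has_log (P ` exterior R) (ratio2 (a i) (b i))) \<and>
     (\<forall>z\<in>exterior R.
        z = P z - 1 / 2 * (\<Sum>i=1..N. c i * log_inf (P ` exterior R) (ratio2 (a i) (b i)) (P z)))"

text \<open>\<open>p\<close> as the function of \<open>z\<close> and of the \<open>a i\<close>, \<open>b i\<close> defined by the Sato relation.\<close>

definition sato_p ::
    "real \<Rightarrow> nat \<Rightarrow> (nat \<Rightarrow> complex) \<Rightarrow> (nat \<Rightarrow> complex) \<Rightarrow> (nat \<Rightarrow> complex) \<Rightarrow>
     complex \<Rightarrow> complex" where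
  "sato_p R N c a b = (SOME P. sato_relation R N c a b P)"

end

theory Submission
  imports Defs
begin

text \<open>
  The vertex identity says \<open>exp (- D(z) S(\<zeta>)) = (p(z) - p(\<zeta>)) / (p(z) + p(\<zeta>))\<close>, so
  \<open>- D(z) S(\<zeta>)\<close> is the logarithm \<open>ln ((p - p(\<zeta>)) / (p + p(\<zeta>)))\<close> written in the variable \<open>z\<close>.
  Since \<open>p(z) = z - D(z) F\<^sub>x\<close>, applying \<open>D(z)\<close> to the constraint yields the Sato function, and
  applying \<open>\<partial>\<^sub>x\<close> to the logarithm yields the generating equation.  The vertex identity also shows
  that \<open>p\<close> is injective outside the unit disc, so that its inverse carries the logarithms
  over to the \<open>p\<close>-plane; expanding it at \<open>z = \<infinity>\<close> gives the first flow.

  The analytic difficulty is that the series \<open>D(z) f\<close> is only assumed to converge pointwise in the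
  times, whereas \<open>\<partial>\<^sub>x\<close> has to be applied to it term by term.  Cauchy estimates for its coefficients
  follow from a bound that is uniform in \<open>x\<close> on one circle \<open>|z| = \<rho>\<close>: for \<open>F\<close> because \<open>D(z) F\<close> is
  \<open>- S_tilde\<close>, which is jointly continuous, and for \<open>S(\<zeta>)\<close> because the exponentials of \<open>\<plusminus> D(z) S(\<zeta>)\<close>
  are explicit in terms of \<open>p\<close> and a holomorphic function vanishing at a point is controlled by
  bounds on the exponentials of itself and of its negative.
\<close>

subsection \<open>Mixed partial derivatives\<close>

text \<open>First-order Taylor expansion. Cauchy's inequality on discs of radius
  \<open>r / 4\<close> around the points of \<open>cball b (r / 2)\<close> bounds the second
  derivative by \<open>2 * M / (r / 4)\<^sup>2\<close>, which is the constant here. It depends on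
  \<open>g\<close> only through \<open>M\<close>, so the estimate is uniform over a bounded
  family.\<close>

lemma difference_quotient_bound:
  fixes g :: "complex \<Rightarrow> complex"
  assumes hol: "g holomorphic_on ball b r" and bd: "\<And>s. s \<in> ball b r \<Longrightarrow> norm (g s) \<le> M"
    and r: "0 < r" and h: "norm h \<le> r / 2" "h \<noteq> 0"
  shows "norm ((g (b + h) - g b) / h - deriv g b) \<le> 32 * M / r\<^sup>2 * norm h"
proof -
  have sub: "cball x (r/4) \<subseteq> ball b r" if "x \<in> cball b (r/2)" for x
  proof
    fix y assume "y \<in> cball x (r/4)"
    then have "dist b y \<le> r/2 + r/4"
      using that dist_triangle[of b y x] by auto
    then show "y \<in> ball b r" using r by simp
  qed
  have 2: "norm ((deriv ^^ 2) g x) \<le> 32 * M / r\<^sup>2" if x: "x \<in> cball b (r/2)" for x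
  proof -
    have "norm ((deriv ^^ 2) g x) \<le> fact 2 * M / (r/4)^2"
    proof (rule Cauchy_inequality)
      show "g holomorphic_on ball x (r/4)"
        by (rule holomorphic_on_subset[OF hol]) (use sub[OF x] in auto)
      show "continuous_on (cball x (r/4)) g"
        by (rule holomorphic_on_imp_continuous_on, rule holomorphic_on_subset[OF hol])
          (use sub[OF x] in auto)
      show "norm (g y) \<le> M" if "norm (x - y) = r/4" for y
        using sub[OF x] that by (intro bd) (auto simp: dist_norm)
    qed (use r in auto)
    then show ?thesis by (simp add: power_divide)
  qed
  have der: "((deriv ^^ i) g has_field_derivative (deriv ^^ Suc i) g x) (at x within cball b (r/2))"
    if "x \<in> cball b (r/2)" for i x
  proof -
    have "(deriv ^^ i) g holomorphic_on ball b r"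
      using hol by (intro holomorphic_higher_deriv) auto
    then show ?thesis
      using that r holomorphic_derivI[of "(deriv ^^ i) g" "ball b r" x] has_field_derivative_at_within
      by fastforce
  qed
  have "norm ((deriv ^^ 0) g (b+h) - (\<Sum>i\<le>1. (deriv ^^ i) g b * (b + h - b) ^ i / fact i))
      \<le> 32 * M / r\<^sup>2 * norm (b + h - b) ^ Suc 1 / fact 1"
    by (rule complex_Taylor[where S = "cball b (r/2)"])
      (use 2 der h r in \<open>auto simp: dist_norm numeral_2_eq_2\<close>)
  then have 1: "norm (g (b+h) - g b - deriv g b * h) \<le> 32 * M / r\<^sup>2 * norm h * norm h"
    by (simp add: power2_eq_square algebra_simps)
  have "(g (b + h) - g b) / h - deriv g b = (g (b+h) - g b - deriv g b * h) / h"
    using h by (simp add: field_simps)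
  then have "norm ((g (b + h) - g b) / h - deriv g b) = norm (g (b+h) - g b - deriv g b * h) / norm h"
    by (simp add: norm_divide)
  also have "\<dots> \<le> 32 * M / r\<^sup>2 * norm h"
    using 1 h by (subst pos_divide_le_eq) auto
  finally show ?thesis .
qed

text \<open>The difference quotients in the second variable are holomorphic in the first and
  converge uniformly by the preceding bound, so Weierstrass' theorem lets the derivative in the
  first variable pass to the limit.\<close>

lemma partial_deriv_uniform_limit:
  fixes \<phi> :: "complex \<Rightarrow> complex \<Rightarrow> complex"
  assumes r: "0 < r"
    and hol1: "\<And>s2. s2 \<in> ball b r \<Longrightarrow> (\<lambda>s1. \<phi> s1 s2) holomorphic_on ball a r"
    and hol2: "\<And>s1. s1 \<in> ball a r \<Longrightarrow> \<phi> s1 holomorphic_on ball b r"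
    and bd: "\<And>s1 s2. s1 \<in> ball a r \<Longrightarrow> s2 \<in> ball b r \<Longrightarrow> norm (\<phi> s1 s2) \<le> M"
    and h: "h \<longlonglongrightarrow> 0" "\<And>n. h n \<noteq> 0" "\<And>n. norm (h n) \<le> r / 2"
  shows "(\<lambda>s1. deriv (\<phi> s1) b) holomorphic_on ball a r"
    and "(\<lambda>n. (deriv (\<lambda>s1. \<phi> s1 (b + h n)) a - deriv (\<lambda>s1. \<phi> s1 b) a) / h n)
            \<longlonglongrightarrow> deriv (\<lambda>s1. deriv (\<phi> s1) b) a"
proof -
  let ?f = "\<lambda>n s. (\<phi> s (b + h n) - \<phi> s b) / h n"
  let ?f' = "\<lambda>n s. (deriv (\<lambda>s1. \<phi> s1 (b + h n)) s - deriv (\<lambda>s1. \<phi> s1 b) s) / h n"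
  have bh: "b + h n \<in> ball b r" for n
    using h(3)[of n] r by (simp add: dist_norm)
  have der: "(?f n has_field_derivative ?f' n s) (at s)" if "s \<in> ball a r" for n s
    using hol1[OF bh, of n] hol1[of b] r that
    by (intro DERIV_cdivide DERIV_diff holomorphic_derivI[of _ "ball a r"]) auto
  have ul: "uniform_limit (ball a r) ?f (\<lambda>s. deriv (\<phi> s) b) sequentially"
  proof (rule uniform_limitI)
    fix e :: real assume e: "0 < e"
    have "(\<lambda>n. 32 * M / r\<^sup>2 * norm (h n)) \<longlonglongrightarrow> 32 * M / r\<^sup>2 * norm (0::complex)"
      by (intro tendsto_intros h)
    then have "\<forall>\<^sub>F n in sequentially. 32 * M / r\<^sup>2 * norm (h n) < e"
      using e by (intro order_tendstoD(2)) auto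
    then show "\<forall>\<^sub>F n in sequentially. \<forall>s\<in>ball a r. dist (?f n s) (deriv (\<phi> s) b) < e"
    proof eventually_elim
      case (elim n)
      show ?case
      proof
        fix s assume "s \<in> ball a r"
        then show "dist (?f n s) (deriv (\<phi> s) b) < e"
          using difference_quotient_bound[of "\<phi> s" b r M "h n"] hol2 bd h r elim
          by (force simp: dist_norm)
      qed
    qed
  qed
  have "\<exists>g'. \<forall>s\<in>ball a r. ((\<lambda>s. deriv (\<phi> s) b) has_field_derivative g' s) (at s) \<and>
          (\<lambda>n. ?f' n s) \<longlonglongrightarrow> g' s"
  proof (rule has_complex_derivative_uniform_sequence[OF _ der])
    show "\<exists>d>0. cball s d \<subseteq> ball a r \<and> uniform_limit (cball s d) ?f (\<lambda>s. deriv (\<phi> s) b) sequentially"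
      if s: "s \<in> ball a r" for s
    proof -
      obtain d where "d > 0" "cball s d \<subseteq> ball a r"
        using open_contains_cball[THEN iffD1, rule_format, OF open_ball s] by auto
      then show ?thesis using uniform_limit_on_subset[OF ul] by blast
    qed
  qed auto
  then obtain g' where g': "\<And>s. s\<in>ball a r \<Longrightarrow> ((\<lambda>s. deriv (\<phi> s) b) has_field_derivative g' s) (at s)"
    and lim: "\<And>s. s\<in>ball a r \<Longrightarrow> (\<lambda>n. ?f' n s) \<longlonglongrightarrow> g' s" by blast
  show "(\<lambda>s1. deriv (\<phi> s1) b) holomorphic_on ball a r"
    unfolding holomorphic_on_open[OF open_ball] using g' by blast
  show "(\<lambda>n. ?f' n a) \<longlonglongrightarrow> deriv (\<lambda>s1. deriv (\<phi> s1) b) a"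
    using lim[of a] DERIV_imp_deriv[OF g'[of a]] r by simp
qed

text \<open>Both mixed derivatives are limits of the same difference quotients along a null
  sequence: one by uniform convergence, the other by the definition of the outer derivative.\<close>

lemma mixed_deriv_commute:
  fixes \<phi> :: "complex \<Rightarrow> complex \<Rightarrow> complex"
  assumes r: "0 < r"
    and hol1: "\<And>s2. s2 \<in> ball b r \<Longrightarrow> (\<lambda>s1. \<phi> s1 s2) holomorphic_on ball a r"
    and hol2: "\<And>s1. s1 \<in> ball a r \<Longrightarrow> \<phi> s1 holomorphic_on ball b r"
    and bd: "\<And>s1 s2. s1 \<in> ball a r \<Longrightarrow> s2 \<in> ball b r \<Longrightarrow> norm (\<phi> s1 s2) \<le> M"
  shows "(\<lambda>s1. deriv (\<phi> s1) b) holomorphic_on ball a r"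
    and "deriv (\<lambda>s1. deriv (\<phi> s1) b) a = deriv (\<lambda>s2. deriv (\<lambda>s1. \<phi> s1 s2) a) b"
proof -
  define h :: "nat \<Rightarrow> complex" where "h = (\<lambda>n. of_real (r / 2) * inverse (of_nat (Suc n)))"
  have h0: "h \<longlonglongrightarrow> 0" unfolding h_def
    using tendsto_mult[OF tendsto_const LIMSEQ_inverse_real_of_nat[THEN tendsto_of_real], of "of_real (r/2) :: complex"]
    by simp
  have hne: "h n \<noteq> 0" for n using r by (simp add: h_def del: of_nat_Suc)
  have hle: "norm (h n) \<le> r / 2" for n
  proof -
    have "norm (h n) = r / 2 * inverse (real (Suc n))"
      using r by (simp add: h_def norm_mult norm_inverse del: of_nat_Suc)
    also have "\<dots> \<le> r / 2 * 1" using r by (intro mult_left_mono) (auto simp: field_simps)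
    finally show ?thesis by simp
  qed
  note * = partial_deriv_uniform_limit[where \<phi> = \<phi> and h = h, OF r hol1 hol2 bd h0 hne hle]
  show "(\<lambda>s1. deriv (\<phi> s1) b) holomorphic_on ball a r" using *(1) .
  \<comment> \<open>With the roles of the variables exchanged, the uniform limit shows that the
    outer derivative in \<open>s2\<close> exists.\<close>
  have "(\<lambda>s2. deriv (\<lambda>s1. \<phi> s1 s2) a) holomorphic_on ball b r"
    by (rule partial_deriv_uniform_limit(1)[where \<phi> = "\<lambda>s2 s1. \<phi> s1 s2" and h = h, OF r hol2 hol1 bd h0 hne hle])
  then have "((\<lambda>s2. deriv (\<lambda>s1. \<phi> s1 s2) a) has_field_derivative
      deriv (\<lambda>s2. deriv (\<lambda>s1. \<phi> s1 s2) a) b) (at b)"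
    using r by (intro holomorphic_derivI[of _ "ball b r"]) auto
  then have "((\<lambda>x. (deriv (\<lambda>s1. \<phi> s1 (b + x)) a - deriv (\<lambda>s1. \<phi> s1 b) a) / x)
      \<longlongrightarrow> deriv (\<lambda>s2. deriv (\<lambda>s1. \<phi> s1 s2) a) b) (at 0)"
    by (simp add: DERIV_def)
  moreover have "filterlim h (at 0) sequentially"
    using h0 hne by (simp add: filterlim_at)
  ultimately have "(\<lambda>n. (deriv (\<lambda>s1. \<phi> s1 (b + h n)) a - deriv (\<lambda>s1. \<phi> s1 b) a) / h n)
      \<longlonglongrightarrow> deriv (\<lambda>s2. deriv (\<lambda>s1. \<phi> s1 s2) a) b"
    by (rule filterlim_compose)
  then show "deriv (\<lambda>s1. deriv (\<phi> s1) b) a = deriv (\<lambda>s2. deriv (\<lambda>s1. \<phi> s1 s2) a) b"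
    using *(2) LIMSEQ_unique by blast
qed

section \<open>Commuting derivatives with respect to the times\<close>

lemma finitely_openD:
  assumes "finitely_open T" "t \<in> T" "finite A"
  obtains \<delta> where "0 < \<delta>" "finite_nbhd A \<delta> t \<subseteq> T"
  using assms unfolding finitely_open_def by blast

text \<open>Continuity in the two times \<open>m\<close> and \<open>n\<close> makes \<open>f\<close>
  bounded on a small bidisc, where \<open>mixed_deriv_commute\<close> applies. For
  \<open>m = n\<close> there is only one variable, and the derivative of a holomorphic function is
  again holomorphic.\<close>

lemma pd_differentiable_and_commute:
  assumes T: "finitely_open T" and f: "times_holomorphic T f" and t: "t \<in> T"
  shows "(\<lambda>x. pd n f (t(m := x))) field_differentiable at (t m)"
    and "pd m (pd n f) t = pd n (pd m f) t"
proof -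
  obtain \<delta>1 where \<delta>1: "0 < \<delta>1" "finite_nbhd {m,n} \<delta>1 t \<subseteq> T"
    using finitely_openD[OF T t, of "{m,n}"] by auto
  obtain \<delta>2 where \<delta>2: "0 < \<delta>2" "\<And>t'. t' \<in> finite_nbhd {m,n} \<delta>2 t \<inter> T \<Longrightarrow> dist (f t') (f t) < 1"
  proof -
    have "\<forall>A. finite A \<longrightarrow> (\<forall>e>0. \<exists>\<delta>>0. \<forall>t' \<in> finite_nbhd A \<delta> t \<inter> T. dist (f t') (f t) < e)"
      using f t by (simp add: times_holomorphic_def)
    from this[rule_format, of "{m,n}" 1] show thesis using that by auto
  qed
  define r where "r = min \<delta>1 \<delta>2"
  have r: "0 < r" using \<delta>1 \<delta>2 by (simp add: r_def)
  have der: "(\<lambda>s. f (t'(k := s))) field_differentiable at (t' k)" if "t' \<in> T" for t' k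
    using f that by (simp add: times_holomorphic_def)
  have inT: "t(m := x, n := y) \<in> T" if "dist (t m) x < r" "dist (t n) y < r" for x y
    using \<delta>1(2) that by (auto simp: finite_nbhd_def r_def dist_commute)
  have inT1: "t(m := x) \<in> T" if "dist (t m) x < r" for x
  proof -
    have "t(m := x) = t(m := x, n := if m = n then x else t n)" by (auto simp: fun_eq_iff)
    moreover have "dist (t n) (if m = n then x else t n) < r" using r that by auto
    ultimately show ?thesis using inT[OF that] by metis
  qed
  have "(\<lambda>x. pd n f (t(m := x))) field_differentiable at (t m) \<and> pd m (pd n f) t = pd n (pd m f) t"
  proof (cases "m = n")
    case True
    have "(\<lambda>s. f (t(n := s))) holomorphic_on ball (t n) r"
    proof (rule holomorphic_onI)
      fix x assume "x \<in> ball (t n) r"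
      then have "(\<lambda>s. f (t(n := s))) field_differentiable at x"
        using der[OF inT1[of x], of n] True by simp
      then show "(\<lambda>s. f (t(n := s))) field_differentiable at x within ball (t n) r"
        by (rule field_differentiable_at_within)
    qed
    then have "deriv (\<lambda>s. f (t(n := s))) holomorphic_on ball (t n) r" by (rule holomorphic_deriv) auto
    then have "deriv (\<lambda>s. f (t(n := s))) field_differentiable at (t n)"
      using r by (intro holomorphic_on_imp_differentiable_at[of _ "ball (t n) r"]) auto
    moreover have "(\<lambda>x. pd n f (t(n := x))) = deriv (\<lambda>s. f (t(n := s)))"
      by (rule ext) (simp add: pd_def)
    ultimately show ?thesis using True by simp
  next
    case False
    define \<phi> where "\<phi> = (\<lambda>x y. f (t(m := x, n := y)))"
    have swap: "t(n := y, m := x) = t(m := x, n := y)" for x y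
      using False by (simp add: fun_upd_twist)
    have h1: "(\<lambda>x. \<phi> x y) holomorphic_on ball (t m) r" if "y \<in> ball (t n) r" for y
    proof (rule holomorphic_onI)
      fix x assume "x \<in> ball (t m) r"
      then show "(\<lambda>x. \<phi> x y) field_differentiable at x within ball (t m) r"
        using der[OF inT[of x y], of m] that False unfolding \<phi>_def swap[symmetric]
        by (auto intro: field_differentiable_at_within)
    qed
    have h2: "(\<lambda>y. \<phi> x y) holomorphic_on ball (t n) r" if "x \<in> ball (t m) r" for x
    proof (rule holomorphic_onI)
      fix y assume "y \<in> ball (t n) r"
      then show "(\<lambda>y. \<phi> x y) field_differentiable at y within ball (t n) r"
        using der[OF inT[of x y], of n] that unfolding \<phi>_def
        by (auto intro: field_differentiable_at_within)
    qed
    have bd: "norm (\<phi> x y) \<le> norm (f t) + 1" if "x \<in> ball (t m) r" "y \<in> ball (t n) r" for x y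
    proof -
      have "t(m := x, n := y) \<in> finite_nbhd {m,n} \<delta>2 t \<inter> T"
        using that inT[of x y] False by (auto simp: finite_nbhd_def r_def dist_commute)
      from \<delta>2(2)[OF this] show ?thesis
        unfolding \<phi>_def dist_norm by (smt (verit) norm_triangle_sub)
    qed
    note * = mixed_deriv_commute[where \<phi> = \<phi>, OF r h1 h2 bd]
    have e1: "(\<lambda>x. pd n f (t(m := x))) = (\<lambda>x. deriv (\<phi> x) (t n))"
      using False by (auto simp: pd_def \<phi>_def fun_eq_iff)
    have e2: "(\<lambda>y. pd m f (t(n := y))) = (\<lambda>y. deriv (\<lambda>x. \<phi> x y) (t m))"
      using False by (auto simp: pd_def \<phi>_def fun_eq_iff swap)
    have "pd m (pd n f) t = pd n (pd m f) t"
      unfolding pd_def[of m "pd n f"] pd_def[of n "pd m f"] e1 e2 using *(2) by simp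
    moreover have "(\<lambda>x. pd n f (t(m := x))) field_differentiable at (t m)"
      unfolding e1 using r by (intro holomorphic_on_imp_differentiable_at[OF *(1)]) auto
    ultimately show ?thesis by simp
  qed
  then show "(\<lambda>x. pd n f (t(m := x))) field_differentiable at (t m)"
    and "pd m (pd n f) t = pd n (pd m f) t" by auto
qed

subsection \<open>The vertex series\<close>

text \<open>Filling in zero coefficients at the even powers produces an ordinary power series, to
  which the theory of power series applies.\<close>

lemma sums_odd_powers:
  fixes w :: complex
  assumes "(\<lambda>n. a n * w ^ (2 * n + 1)) sums s"
  shows "(\<lambda>m. (if odd m then a (m div 2) else 0) * w ^ m) sums s"
proof -
  have "(\<lambda>n. (if odd (2 * n + 1) then a ((2 * n + 1) div 2) else 0) * w ^ (2 * n + 1)) sums s"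
    using assms by simp
  then show ?thesis
    by (subst (asm) sums_mono_reindex[of "\<lambda>n. 2 * n + 1"]) (auto simp: strict_mono_def elim!: oddE)
qed

text \<open>The coefficient of \<open>w ^ m\<close> in \<open>vertex_op (inverse w) f t\<close>,
  i.e. of the series in the local coordinate \<open>w = 1 / z\<close> at infinity; the factor 2 of
  the vertex operator is included.\<close>

definition vertex_coeff :: "(times \<Rightarrow> complex) \<Rightarrow> times \<Rightarrow> nat \<Rightarrow> complex" where
  "vertex_coeff f t m = (if odd m then 2 * pd (m div 2) f t / of_nat m else 0)"

lemma vertex_term_inverse:
  "vertex_term (inverse w) f t n = w ^ (2 * n + 1) / of_nat (2 * n + 1) * pd n f t"
  by (simp add: vertex_term_def power_inverse)

text \<open>Since \<open>inverse 0 = 0\<close>, the power series in \<open>w\<close> represents \<open>vertex_op (inverse w) f t\<close> at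
  \<open>w = 0\<close> as well.\<close>

lemma vertex_summable_zero: "vertex_summable 0 f t"
  by (simp add: vertex_summable_def vertex_term_def[abs_def])

lemma vertex_op_zero: "vertex_op 0 f t = 0"
  by (simp add: vertex_op_def vertex_term_def[abs_def])

lemma vertex_series_sums:
  assumes "vertex_summable (inverse w) f t"
  shows "(\<lambda>m. vertex_coeff f t m * w ^ m) sums vertex_op (inverse w) f t"
proof -
  have "(\<lambda>n. 2 * vertex_term (inverse w) f t n) sums vertex_op (inverse w) f t"
    using assms unfolding vertex_summable_def vertex_op_def
    by (intro sums_mult summable_sums)
  then have "(\<lambda>n. (2 * pd n f t / of_nat (2 * n + 1)) * w ^ (2 * n + 1)) sums vertex_op (inverse w) f t"
    unfolding vertex_term_inverse by (simp add: field_simps)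
  from sums_odd_powers[OF this] show ?thesis
    by (rule sums_cong[THEN iffD1, rotated]) (auto simp: vertex_coeff_def elim!: oddE)
qed

lemma norm_inverse_less:
  fixes z :: complex
  assumes "0 < r" "r < norm z"
  shows "norm (inverse z) < 1 / r"
  using assms less_imp_inverse_less[of r "norm z"]
  by (simp add: norm_inverse norm_divide inverse_eq_divide)

context
  fixes f t and R0 :: real
  assumes R0: "0 < R0" and summ: "\<And>z. R0 < norm z \<Longrightarrow> vertex_summable z f t"
begin

lemma vertex_power_series:
  assumes "w \<in> ball 0 (1 / R0)"
  shows "(\<lambda>m. vertex_coeff f t m * w ^ m) sums vertex_op (inverse w) f t"
proof (rule vertex_series_sums, cases "w = 0")
  case True
  then show "vertex_summable (inverse w) f t" by (simp add: vertex_summable_zero)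
next
  case False
  then show "vertex_summable (inverse w) f t"
    using assms R0 by (intro summ) (simp add: norm_inverse norm_divide field_simps)
qed

lemma vertex_series_holomorphic: "(\<lambda>w. vertex_op (inverse w) f t) holomorphic_on ball 0 (1 / R0)"
  by (rule power_series_holomorphic[where a = "vertex_coeff f t"]) (use vertex_power_series in auto)

lemma vertex_series_fps: "(\<lambda>w. vertex_op (inverse w) f t) has_fps_expansion Abs_fps (vertex_coeff f t)"
proof (rule has_fps_expansionI)
  have "\<forall>\<^sub>F w in nhds 0. w \<in> ball (0::complex) (1 / R0)"
    using R0 by (intro eventually_nhds_in_open) auto
  then show "\<forall>\<^sub>F w in nhds 0. (\<lambda>n. Abs_fps (vertex_coeff f t) $ n * w ^ n) sums vertex_op (inverse w) f t"
    by eventually_elim (use vertex_power_series in auto)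
qed

lemma vertex_op_holomorphic: "(\<lambda>z. vertex_op z f t) holomorphic_on exterior R0"
proof -
  have "(\<lambda>w. vertex_op (inverse w) f t) \<circ> inverse holomorphic_on exterior R0"
    using R0 by (intro holomorphic_on_compose_gen[OF _ vertex_series_holomorphic] holomorphic_intros)
      (use norm_inverse_less[OF R0] in \<open>auto simp: exterior_def\<close>)
  then show ?thesis by (simp add: o_def)
qed

text \<open>Cauchy's inequality on the circle \<open>norm w = 1 / \<rho>\<close>, the image of
  \<open>norm z = \<rho>\<close> under inversion.\<close>

lemma vertex_coeff_bound:
  assumes \<rho>: "R0 < \<rho>" and bd: "\<And>z. norm z = \<rho> \<Longrightarrow> norm (vertex_op z f t) \<le> M"
  shows "norm (vertex_coeff f t m) \<le> M * \<rho> ^ m"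
proof -
  have "vertex_coeff f t m = (deriv ^^ m) (\<lambda>w. vertex_op (inverse w) f t) 0 / fact m"
    using fps_nth_fps_expansion[OF vertex_series_fps, of m] by simp
  moreover have "norm ((deriv ^^ m) (\<lambda>w. vertex_op (inverse w) f t) 0) \<le> fact m * M / (1 / \<rho>) ^ m"
  proof (rule Cauchy_inequality)
    have sub: "cball 0 (1 / \<rho>) \<subseteq> ball (0::complex) (1 / R0)"
    proof -
      have "1 / \<rho> < 1 / R0" using \<rho> R0 by (intro divide_strict_left_mono) auto
      then show ?thesis by auto
    qed
    show "(\<lambda>w. vertex_op (inverse w) f t) holomorphic_on ball 0 (1 / \<rho>)"
      by (rule holomorphic_on_subset[OF vertex_series_holomorphic]) (use sub in auto)
    show "continuous_on (cball 0 (1 / \<rho>)) (\<lambda>w. vertex_op (inverse w) f t)"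
      by (rule holomorphic_on_imp_continuous_on, rule holomorphic_on_subset[OF vertex_series_holomorphic sub])
    show "norm (vertex_op (inverse w) f t) \<le> M" if "norm (0 - w) = 1 / \<rho>" for w
      using that by (intro bd) (simp add: norm_inverse)
  qed (use R0 \<rho> in auto)
  ultimately have "norm (vertex_coeff f t m) \<le> fact m * M / (1 / \<rho>) ^ m / fact m"
    by (simp only: norm_divide norm_fact divide_right_mono fact_ge_zero)
  also have "\<dots> = M * \<rho> ^ m" by (simp add: power_one_over)
  finally show ?thesis .
qed

text \<open>A bound for the sum on one circle thus yields a majorant for the single terms that is
  the same for all \<open>z\<close> with \<open>\<rho>' \<le> norm z\<close>; it is geometric and
  summable once \<open>\<rho> < \<rho>'\<close>.\<close>

lemma vertex_term_bound:
  assumes \<rho>: "R0 < \<rho>" and bd: "\<And>z. norm z = \<rho> \<Longrightarrow> norm (vertex_op z f t) \<le> M"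
    and \<rho>': "0 < \<rho>'" "\<rho>' \<le> norm z"
  shows "norm (vertex_term z f t n) \<le> M * (\<rho> / \<rho>') ^ (2 * n + 1)"
proof -
  have M: "0 \<le> M"
    using bd[of "of_real \<rho>"] R0 \<rho> norm_ge_zero[of "vertex_op (of_real \<rho>) f t"] by (simp del: norm_ge_zero)
  define a where "a = pd n f t / of_nat (2 * n + 1)"
  have "vertex_coeff f t (2 * n + 1) = 2 * a"
    by (simp add: vertex_coeff_def a_def)
  moreover have "vertex_term z f t n = inverse (z ^ (2 * n + 1)) * a"
    by (simp add: vertex_term_def a_def)
  ultimately have "vertex_term z f t n = inverse (z ^ (2 * n + 1)) * vertex_coeff f t (2 * n + 1) / 2"
    by simp
  then have "norm (vertex_term z f t n) = inverse (norm z ^ (2 * n + 1)) * norm (vertex_coeff f t (2 * n + 1)) / 2"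
    by (simp only: norm_mult norm_divide norm_inverse norm_power norm_numeral)
  also have "\<dots> \<le> inverse (\<rho>' ^ (2 * n + 1)) * (M * \<rho> ^ (2 * n + 1)) / 2"
    using \<rho>' vertex_coeff_bound[OF \<rho> bd, of "2 * n + 1"]
    by (intro divide_right_mono mult_mono le_imp_inverse_le power_mono) auto
  also have "\<dots> \<le> inverse (\<rho>' ^ (2 * n + 1)) * (M * \<rho> ^ (2 * n + 1))"
    using M R0 \<rho> \<rho>' by simp
  also have "\<dots> = M * (\<rho> / \<rho>') ^ (2 * n + 1)"
    by (simp add: power_divide field_simps)
  finally show ?thesis .
qed

end

lemma summable_odd_geometric:
  fixes q :: real
  assumes "0 \<le> q" "q < 1"
  shows "summable (\<lambda>n. M * q ^ (2 * n + 1))"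
proof -
  have "q\<^sup>2 < 1" using assms by (simp add: power_less_one_iff abs_square_less_1)
  then have "summable (\<lambda>n. (M * q) * (q\<^sup>2) ^ n)"
    using assms by (intro summable_mult summable_geometric) auto
  moreover have "(\<lambda>n. (M * q) * (q\<^sup>2) ^ n) = (\<lambda>n. M * q ^ (2 * n + 1))"
    by (auto simp: fun_eq_iff power_mult)
  ultimately show ?thesis by metis
qed

subsection \<open>Termwise differentiation of the vertex series\<close>

text \<open>Isolates what termwise differentiation in \<open>x\<close> requires: beyond
  \<open>R0\<close> the series converges pointwise, and on the single circle
  \<open>norm z = \<rho>\<close> its sum is bounded uniformly in \<open>x\<close>. Cauchy estimates
  then control it for all \<open>norm z > \<rho>\<close>.\<close>

locale vertex_bounded =
  fixes T f t and R0 \<rho> d M :: real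
  assumes T: "finitely_open T" and f: "times_holomorphic T f"
    and R0: "0 < R0" and \<rho>: "R0 < \<rho>" and d: "0 < d"
    and inT: "\<And>x. x \<in> ball (t 0) d \<Longrightarrow> t(0 := x) \<in> T"
    and summ: "\<And>x z. x \<in> ball (t 0) d \<Longrightarrow> R0 < norm z \<Longrightarrow> vertex_summable z f (t(0 := x))"
    and bd: "\<And>x z. x \<in> ball (t 0) d \<Longrightarrow> norm z = \<rho> \<Longrightarrow> norm (vertex_op z f (t(0 := x))) \<le> M"
begin

text \<open>Commuting the two derivatives puts \<open>pd 0\<close> next to \<open>f\<close>, so that
  the differentiated series is again a vertex series, namely that of \<open>pd 0 f\<close>.\<close>

lemma pd_derivative:
  assumes "x \<in> ball (t 0) d"
  shows "((\<lambda>x. pd n f (t(0 := x))) has_field_derivative pd n (pd 0 f) (t(0 := x))) (at x)"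
proof -
  note * = pd_differentiable_and_commute[OF T f inT[OF assms], of n 0]
  have "((\<lambda>x. pd n f (t(0 := x))) has_field_derivative deriv (\<lambda>x. pd n f (t(0 := x))) x) (at x)"
    using *(1) by (simp add: field_differentiable_derivI)
  also have "deriv (\<lambda>x. pd n f (t(0 := x))) x = pd 0 (pd n f) (t(0 := x))"
    by (simp add: pd_def[of 0])
  finally show ?thesis by (simp only: *(2))
qed

lemma term_derivative:
  assumes "x \<in> ball (t 0) d"
  shows "((\<lambda>x. vertex_term z f (t(0 := x)) n) has_field_derivative vertex_term z (pd 0 f) (t(0 := x)) n) (at x)"
  unfolding vertex_term_def by (intro DERIV_cmult pd_derivative assms)

lemma term_bound:
  assumes "x \<in> ball (t 0) d" "0 < \<rho>'" "\<rho>' \<le> norm z"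
  shows "norm (vertex_term z f (t(0 := x)) n) \<le> M * (\<rho> / \<rho>') ^ (2 * n + 1)"
  by (rule vertex_term_bound[OF R0 summ[OF assms(1)] \<rho> bd[OF assms(1)] assms(2,3)])

text \<open>The majorant with \<open>\<rho>' = norm z\<close> does not depend on \<open>x\<close>,
  so the series may be differentiated term by term; convergence of the differentiated series is part
  of the result.\<close>

lemma vertex_op_derivative:
  assumes x: "x \<in> ball (t 0) d" and z: "\<rho> < norm z"
  shows "vertex_summable z (pd 0 f) (t(0 := x))"
    and "((\<lambda>x. vertex_op z f (t(0 := x))) has_field_derivative vertex_op z (pd 0 f) (t(0 := x))) (at x)"
proof -
  have zpos: "0 < norm z" using R0 \<rho> z by linarith
  have 1: "summable (\<lambda>n. M * (\<rho> / norm z) ^ (2 * n + 1))"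
    using z R0 \<rho> zpos by (intro summable_odd_geometric) auto
  have 2: "\<forall>\<^sub>F n in sequentially. \<forall>x\<in>ball (t 0) d.
      norm (vertex_term z f (t(0 := x)) n) \<le> M * (\<rho> / norm z) ^ (2 * n + 1)"
    by (intro always_eventually allI ballI term_bound zpos order_refl)
  obtain g g' where "\<forall>x\<in>ball (t 0) d.
      (\<lambda>n. vertex_term z f (t(0 := x)) n) sums g x \<and>
      (\<lambda>n. vertex_term z (pd 0 f) (t(0 := x)) n) sums g' x \<and> (g has_field_derivative g' x) (at x)"
    by (rule series_and_derivative_comparison[OF open_ball 1 term_derivative 2])
  then have g: "\<And>x. x \<in> ball (t 0) d \<Longrightarrow>
      (\<lambda>n. vertex_term z f (t(0 := x)) n) sums g x \<and>
      (\<lambda>n. vertex_term z (pd 0 f) (t(0 := x)) n) sums g' x \<and> (g has_field_derivative g' x) (at x)"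
    by blast
  show "vertex_summable z (pd 0 f) (t(0 := x))"
    using g[OF x] by (auto simp: vertex_summable_def sums_iff)
  have "((\<lambda>x. 2 * g x) has_field_derivative 2 * g' x) (at x)"
    using g[OF x] by (intro DERIV_cmult) auto
  moreover have "2 * g' x = vertex_op z (pd 0 f) (t(0 := x))"
    using g[OF x] by (auto simp: vertex_op_def sums_iff)
  moreover have "vertex_op z f (t(0 := y)) = 2 * g y" if "y \<in> ball (t 0) d" for y
    using g[OF that] by (auto simp: vertex_op_def sums_iff)
  ultimately show "((\<lambda>x. vertex_op z f (t(0 := x))) has_field_derivative vertex_op z (pd 0 f) (t(0 := x))) (at x)"
    using has_field_derivative_transform_within_open[of "\<lambda>x. 2 * g x" _ x "ball (t 0) d"] x
    by auto
qed

text \<open>Weierstrass M-test for the differentiated series, jointly in \<open>z\<close> and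
  \<open>x\<close>. Cauchy's inequality in \<open>x\<close> on discs of radius \<open>d / 4\<close>
  bounds its terms, at the price of halving the disc in which \<open>x\<close> varies.\<close>

lemma vertex_op_pd_continuous:
  assumes \<rho>': "\<rho> < \<rho>'"
  shows "continuous_on ({z. \<rho>' \<le> norm z} \<times> cball (t 0) (d / 2))
           (\<lambda>(z, x). vertex_op z (pd 0 f) (t(0 := x)))"
proof -
  let ?A = "{z::complex. \<rho>' \<le> norm z} \<times> cball (t 0) (d / 2)"
  let ?F = "\<lambda>n (z, x). vertex_term z (pd 0 f) (t(0 := x)) n"
  \<comment> \<open>The factor \<open>4 / d\<close> comes from Cauchy's inequality on a disc of
    radius \<open>d / 4\<close>; the rest bounds the undifferentiated terms.\<close>
  define B where "B = (\<lambda>n. M * (4 / d) * (\<rho> / \<rho>') ^ (2 * n + 1))"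
  have pos: "0 < \<rho>'" using R0 \<rho> \<rho>' by linarith
  have sub: "cball x (d / 4) \<subseteq> ball (t 0) d" if "x \<in> cball (t 0) (d / 2)" for x
  proof
    fix y assume "y \<in> cball x (d / 4)"
    then have "dist (t 0) y \<le> d / 2 + d / 4"
      using that dist_triangle[of "t 0" y x] by auto
    then show "y \<in> ball (t 0) d" using d by simp
  qed
  have cont: "continuous_on ?A (?F n)" for n
  proof -
    have "(\<lambda>x. pd n f (t(0 := x))) holomorphic_on ball (t 0) d"
      unfolding holomorphic_on_open[OF open_ball] using pd_derivative by blast
    then have "deriv (\<lambda>x. pd n f (t(0 := x))) holomorphic_on ball (t 0) d"
      by (rule holomorphic_deriv) auto
    then have "continuous_on (ball (t 0) d) (\<lambda>x. pd n (pd 0 f) (t(0 := x)))"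
      using DERIV_imp_deriv[OF pd_derivative, of _ n] holomorphic_on_imp_continuous_on
        continuous_on_cong[of "ball (t 0) d" "ball (t 0) d" "deriv (\<lambda>x. pd n f (t(0 := x)))"
          "\<lambda>x. pd n (pd 0 f) (t(0 := x))"] by auto
    then have "continuous_on (cball (t 0) (d / 2)) (\<lambda>x. pd n (pd 0 f) (t(0 := x)))"
      by (rule continuous_on_subset) (use d in auto)
    then have "continuous_on ?A (\<lambda>q. pd n (pd 0 f) (t(0 := snd q)))"
      by (rule continuous_on_compose2) (auto intro!: continuous_intros)
    moreover have "(of_nat (2 * n + 1) :: complex) \<noteq> 0" by (simp only: of_nat_eq_0_iff)
    ultimately show ?thesis
      unfolding vertex_term_def case_prod_beta
      by (intro continuous_intros) (use pos in auto)
  qed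
  have bound: "norm (?F n q) \<le> B n" if "q \<in> ?A" for n q
  proof -
    obtain z x where q: "q = (z, x)" and z: "\<rho>' \<le> norm z" and x: "x \<in> cball (t 0) (d / 2)"
      using \<open>q \<in> ?A\<close> by auto
    have hol: "(\<lambda>x. vertex_term z f (t(0 := x)) n) holomorphic_on ball (t 0) d"
      unfolding holomorphic_on_open[OF open_ball] using term_derivative by blast
    have "norm ((deriv ^^ 1) (\<lambda>x. vertex_term z f (t(0 := x)) n) x)
        \<le> fact 1 * (M * (\<rho> / \<rho>') ^ (2 * n + 1)) / (d / 4) ^ 1"
    proof (rule Cauchy_inequality)
      show "(\<lambda>x. vertex_term z f (t(0 := x)) n) holomorphic_on ball x (d / 4)"
        by (rule holomorphic_on_subset[OF hol]) (use sub[OF x] in auto)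
      show "continuous_on (cball x (d / 4)) (\<lambda>x. vertex_term z f (t(0 := x)) n)"
        by (rule holomorphic_on_imp_continuous_on, rule holomorphic_on_subset[OF hol])
          (use sub[OF x] in auto)
      show "norm (vertex_term z f (t(0 := y)) n) \<le> M * (\<rho> / \<rho>') ^ (2 * n + 1)"
        if "norm (x - y) = d / 4" for y
        by (rule term_bound[OF _ pos z]) (use sub[OF x] that in \<open>auto simp: dist_norm\<close>)
    qed (use d in auto)
    moreover have "deriv (\<lambda>x. vertex_term z f (t(0 := x)) n) x = vertex_term z (pd 0 f) (t(0 := x)) n"
      by (rule DERIV_imp_deriv, rule term_derivative) (use subsetD[OF sub[OF x], of x] d in auto)
    ultimately show ?thesis by (simp add: q B_def mult_ac)
  qed
  have "summable B"
    unfolding B_def using \<rho>' R0 \<rho> pos by (intro summable_odd_geometric) auto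
  then have "uniform_limit ?A (\<lambda>n q. \<Sum>i<n. ?F i q) (\<lambda>q. \<Sum>i. ?F i q) sequentially"
    by (intro Weierstrass_m_test[where M = B] bound)
  then have "continuous_on ?A (\<lambda>q. \<Sum>i. ?F i q)"
    by (rule uniform_limit_theorem[rotated]) (auto intro!: always_eventually continuous_on_sum cont)
  then have "continuous_on ?A (\<lambda>q. 2 * (\<Sum>i. ?F i q))"
    by (intro continuous_intros)
  then show ?thesis
    by (simp add: vertex_op_def case_prod_beta)
qed

end

subsection \<open>A bound for holomorphic logarithms\<close>

text \<open>The maximum principle carries both bounds from the circle into the disc. Cauchy's
  inequality bounds the derivative of \<open>exp (K w)\<close>, and multiplying it by
  \<open>exp (- K w)\<close> leaves \<open>deriv K w\<close>. The mean value inequality from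
  \<open>K 0 = 0\<close> then bounds \<open>K\<close>.\<close>

lemma holomorphic_log_bound:
  assumes hol: "K holomorphic_on ball 0 r2" and r: "0 < r'" "r' < r" "r < r2"
    and bd: "\<And>w. norm w = r \<Longrightarrow> norm (exp (K w)) \<le> M" "\<And>w. norm w = r \<Longrightarrow> norm (exp (- K w)) \<le> M"
    and K0: "K 0 = 0" and w: "norm w \<le> r'"
  shows "norm (K w) \<le> M * M / (r - r') * r'"
proof -
  have holc: "K holomorphic_on cball 0 r"
    by (rule holomorphic_on_subset[OF hol]) (use r in auto)
  \<comment> \<open>The sign \<open>s\<close> treats \<open>exp (K v)\<close> and
    \<open>exp (- K v)\<close> at once.\<close>
  have max: "norm (exp (s * K v)) \<le> M" if "norm v \<le> r" "s = 1 \<or> s = -1" for s v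
  proof (rule maximum_modulus_frontier[of "\<lambda>w. exp (s * K w)" "cball 0 r"])
    show "(\<lambda>w. exp (s * K w)) holomorphic_on interior (cball 0 r)"
      by (intro holomorphic_intros holomorphic_on_subset[OF holc] interior_subset)
    show "continuous_on (closure (cball 0 r)) (\<lambda>w. exp (s * K w))"
      by (intro continuous_intros holomorphic_on_imp_continuous_on holomorphic_on_subset[OF holc]) auto
    show "norm (exp (s * K u)) \<le> M" if "u \<in> frontier (cball 0 r)" for u
      using that \<open>s = 1 \<or> s = -1\<close> bd[of u] r by auto
  qed (use that in auto)
  have M: "0 \<le> M" using order_trans[OF norm_ge_zero max[of 0 1]] r by simp
  have der: "(K has_field_derivative deriv K v) (at v)" if "norm v < r2" for v
    using hol that by (intro holomorphic_derivI[of _ "ball 0 r2"]) auto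
  have dbd: "norm (deriv K v) \<le> M * M / (r - r')" if v: "norm v \<le> r'" for v
  proof -
    have sub: "cball v (r - r') \<subseteq> cball 0 r"
    proof
      fix u assume "u \<in> cball v (r - r')"
      then have "norm (v - u) \<le> r - r'" by (simp add: dist_norm)
      moreover have "norm u \<le> norm v + norm (v - u)"
        using norm_triangle_sub[of u v] by (simp add: norm_minus_commute)
      ultimately show "u \<in> cball 0 r" using v by simp
    qed
    have "norm ((deriv ^^ 1) (\<lambda>w. exp (K w)) v) \<le> fact 1 * M / (r - r') ^ 1"
    proof (rule Cauchy_inequality)
      show "(\<lambda>w. exp (K w)) holomorphic_on ball v (r - r')"
        by (intro holomorphic_intros holomorphic_on_subset[OF holc]) (use sub in auto)
      show "continuous_on (cball v (r - r')) (\<lambda>w. exp (K w))"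
        by (intro continuous_intros holomorphic_on_imp_continuous_on holomorphic_on_subset[OF holc] sub)
      show "norm (exp (K u)) \<le> M" if "norm (v - u) = r - r'" for u
      proof -
        have "u \<in> cball v (r - r')" using that by (simp add: dist_norm)
        then have "u \<in> cball 0 r" using sub by blast
        then show ?thesis using max[of u 1] by simp
      qed
    qed (use r in auto)
    moreover have "deriv (\<lambda>w. exp (K w)) v = exp (K v) * deriv K v"
      by (rule DERIV_imp_deriv) (use der[of v] v r in \<open>auto intro!: derivative_eq_intros\<close>)
    ultimately have 1: "norm (exp (K v) * deriv K v) \<le> M / (r - r')" by simp
    have "deriv K v = (exp (K v) * deriv K v) * exp (- 1 * K v)"
      by (simp add: exp_minus)
    then have "norm (deriv K v) = norm (exp (K v) * deriv K v) * norm (exp (- 1 * K v))"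
      by (metis norm_mult)
    also have "\<dots> \<le> (M / (r - r')) * M"
      using 1 max[of v "-1"] v r M by (intro mult_mono) auto
    finally show ?thesis by simp
  qed
  have "norm (K w - K 0) \<le> M * M / (r - r') * norm (w - 0)"
  proof (rule field_differentiable_bound[of "cball 0 r'" K "deriv K"])
    show "(K has_field_derivative deriv K z) (at z within cball 0 r')" if "z \<in> cball 0 r'" for z
      using der[of z] that r has_field_derivative_at_within by auto
  qed (use dbd w r in auto)
  also have "\<dots> \<le> M * M / (r - r') * r'"
    using w M r by (intro mult_left_mono) auto
  finally show ?thesis using K0 by simp
qed

subsection \<open>Solutions with a tau-function\<close>

lemma finitely_open_line:
  assumes "finitely_open T" "t \<in> T"
  obtains d where "0 < d" "\<And>x. x \<in> cball (t n) d \<Longrightarrow> t(n := x) \<in> T"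
proof -
  obtain \<delta> where \<delta>: "0 < \<delta>" "finite_nbhd {n} \<delta> t \<subseteq> T"
    using finitely_openD[OF assms, of "{n}"] by auto
  show thesis
  proof (rule that[of "\<delta> / 2"])
    fix x assume "x \<in> cball (t n) (\<delta> / 2)"
    then show "t(n := x) \<in> T"
      using \<delta> by (intro subsetD[OF \<delta>(2)]) (auto simp: finite_nbhd_def dist_commute)
  qed (use \<delta> in simp)
qed

lemma eventually_line:
  assumes "finitely_open T" "t \<in> T"
  shows "\<forall>\<^sub>F x in nhds (t n). t(n := x) \<in> T"
proof -
  obtain d where d: "0 < d" "\<And>x. x \<in> cball (t n) d \<Longrightarrow> t(n := x) \<in> T"
    using finitely_open_line[OF assms] by blast
  have "\<forall>\<^sub>F x in nhds (t n). x \<in> ball (t n) d"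
    using d by (intro eventually_nhds_in_open) auto
  then show ?thesis by eventually_elim (use d in auto)
qed

lemma pd_cong:
  assumes "finitely_open T" "t \<in> T" "\<And>t. t \<in> T \<Longrightarrow> f t = g t"
  shows "pd n f t = pd n g t"
  unfolding pd_def
  by (rule deriv_cong_ev) (use eventually_line[OF assms(1,2), of n] assms(3) in \<open>auto elim: eventually_mono\<close>)

lemma times_holomorphic_derivative:
  assumes "times_holomorphic T f" "t \<in> T"
  shows "((\<lambda>s. f (t(n := s))) has_field_derivative pd n f t) (at (t n))"
  using assms unfolding times_holomorphic_def pd_def by (simp add: field_differentiable_derivI)

text \<open>Twice the series of artanh: subtracting the logarithm series at \<open>- v\<close> from
  that at \<open>v\<close> cancels the even powers and doubles the odd ones.\<close>

lemma artanh_sums: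
  fixes v :: complex
  assumes "norm v < 1"
  shows "(\<lambda>n. 2 * (v ^ (2 * n + 1) / of_nat (2 * n + 1))) sums (Ln (1 + v) - Ln (1 - v))"
proof -
  define f where "f = (\<lambda>n. (-1) ^ Suc n / of_nat n * v ^ n - (-1) ^ Suc n / of_nat n * (- v) ^ n :: complex)"
  have "f sums (Ln (1 + v) - Ln (1 + (- v)))"
    unfolding f_def by (intro sums_diff Ln_series) (use assms in auto)
  moreover have "f n = 0" if "n \<notin> range (\<lambda>n. 2 * n + 1)" for n
  proof -
    have "even n" using that by (metis oddE rangeI)
    then show ?thesis by (simp add: f_def)
  qed
  ultimately have "(\<lambda>n. f (2 * n + 1)) sums (Ln (1 + v) - Ln (1 - v))"
    by (subst sums_mono_reindex) (auto simp: strict_mono_def)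
  then show ?thesis by (simp add: f_def)
qed

text \<open>Only one term of the series changes, so \<open>S0\<close> is affine in each single
  time.\<close>

lemma S0_update:
  assumes "summable (\<lambda>n. t n * z ^ (2 * n + 1))"
  shows "S0 z (t(n := s)) = S0 z t + (s - t n) * z ^ (2 * n + 1)"
proof -
  have "(\<lambda>k. t k * z ^ (2 * k + 1) + (if k = n then (s - t n) * z ^ (2 * n + 1) else 0))
      sums (S0 z t + (s - t n) * z ^ (2 * n + 1))"
    unfolding S0_def using assms sums_single[of n "\<lambda>_. (s - t n) * z ^ (2 * n + 1)"]
    by (intro sums_add summable_sums)
  also have "(\<lambda>k. t k * z ^ (2 * k + 1) + (if k = n then (s - t n) * z ^ (2 * n + 1) else 0))
      = (\<lambda>k. (t(n := s)) k * z ^ (2 * k + 1))"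
    by (auto simp: fun_eq_iff algebra_simps)
  finally show ?thesis unfolding S0_def by (simp add: sums_iff)
qed

section \<open>Consequences of the vertex identity for the momentum\<close>

context dBKP_solution
begin

lemma momentum_eq_pd: "momentum S z = pd 0 (S z)"
  by (simp add: fun_eq_iff momentum_def)

lemma S_update:
  assumes "t \<in> T"
  shows "S z (t(n := s)) = S_tilde S z (t(n := s)) + S0 z t + (s - t n) * z ^ (2 * n + 1)"
  by (simp only: S_tilde_def S0_update[OF S0_summable[OF assms]]) simp

lemma pd_S_tilde:
  assumes t: "t \<in> T"
  shows "pd n (S_tilde S z) t = pd n (S z) t - z ^ (2 * n + 1)"
proof -
  have "((\<lambda>s. S z (t(n := s)) - (S0 z t + (s - t n) * z ^ (2 * n + 1)))
      has_field_derivative pd n (S z) t - z ^ (2 * n + 1)) (at (t n))"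
    by (rule derivative_eq_intros times_holomorphic_derivative[OF S_holomorphic_times t] refl | simp)+
  also have "(\<lambda>s. S z (t(n := s)) - (S0 z t + (s - t n) * z ^ (2 * n + 1))) = (\<lambda>s. S_tilde S z (t(n := s)))"
    using S_update[OF t] by (auto simp: fun_eq_iff)
  finally show ?thesis unfolding pd_def[of n "S_tilde S z"] by (rule DERIV_imp_deriv)
qed

text \<open>For \<open>norm \<zeta> < norm z\<close> the series of the vertex operator applied to
  \<open>S0 \<zeta>\<close> converges to the logarithm in \<open>vertex_identity\<close>, up to the
  choice of branch, so the operator may be applied to all of \<open>S \<zeta>\<close>.\<close>

lemma vertex_S:
  assumes t: "t \<in> T" and z: "1 < norm z" "norm \<zeta> < norm z"
  shows "vertex_summable z (S \<zeta>) t"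
    and "exp (- vertex_op z (S \<zeta>) t)
          = (momentum S z t - momentum S \<zeta> t) / (momentum S z t + momentum S \<zeta> t)"
proof -
  define v where "v = \<zeta> / z"
  have z0: "z \<noteq> 0" using z by auto
  have v: "norm v < 1" using z by (simp add: v_def norm_divide divide_less_eq_1)
  have v1: "1 + v \<noteq> 0" "1 - v \<noteq> 0"
    using v by (auto simp: add_eq_0_iff)
  have 1: "(\<lambda>n. 2 * vertex_term z (S_tilde S \<zeta>) t n) sums vertex_op z (S_tilde S \<zeta>) t"
    using vertex_S_tilde_summable[OF t z(1)] unfolding vertex_summable_def vertex_op_def
    by (intro sums_mult summable_sums)
  have "2 * vertex_term z (S \<zeta>) t n
      = 2 * vertex_term z (S_tilde S \<zeta>) t n + 2 * (v ^ (2 * n + 1) / of_nat (2 * n + 1))" for n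
  proof -
    have "v ^ (2 * n + 1) = inverse (z ^ (2 * n + 1)) * \<zeta> ^ (2 * n + 1)"
      by (simp only: v_def divide_inverse power_mult_distrib power_inverse mult.commute)
    moreover have "pd n (S \<zeta>) t = pd n (S_tilde S \<zeta>) t + \<zeta> ^ (2 * n + 1)"
      using pd_S_tilde[OF t, of n \<zeta>] by simp
    ultimately show ?thesis
      unfolding vertex_term_def by (simp only: distrib_left times_divide_eq_left)
  qed
  then have "(\<lambda>n. 2 * vertex_term z (S \<zeta>) t n) sums
      (vertex_op z (S_tilde S \<zeta>) t + (Ln (1 + v) - Ln (1 - v)))"
    using sums_add[OF 1 artanh_sums[OF v]] by simp
  from sums_mult[OF this, of "1 / 2"] have
    s: "vertex_term z (S \<zeta>) t sums ((vertex_op z (S_tilde S \<zeta>) t + (Ln (1 + v) - Ln (1 - v))) / 2)"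
    by simp
  then show "vertex_summable z (S \<zeta>) t"
    by (simp add: vertex_summable_def sums_iff)
  from s have op: "vertex_op z (S \<zeta>) t = vertex_op z (S_tilde S \<zeta>) t + (Ln (1 + v) - Ln (1 - v))"
    unfolding vertex_op_def[of z "S \<zeta>"] sums_unique[OF s, symmetric] by simp
  have ne: "z - \<zeta> \<noteq> 0" "z + \<zeta> \<noteq> 0" "\<zeta> \<noteq> z" "\<zeta> \<noteq> - z"
    using z by (auto simp: add_eq_0_iff)
  \<comment> \<open>The two expressions for the logarithm are compared only after exponentiation, so
    their branches need not be matched.\<close>
  have "exp (Ln (1 + v) - Ln (1 - v)) = (1 + v) / (1 - v)"
    using v1 by (simp add: exp_diff)
  also have "\<dots> = (z + \<zeta>) / (z - \<zeta>)"
    using z0 ne v1 by (simp add: v_def field_simps)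
  also have "\<dots> = exp (Ln ((z + \<zeta>) / (z - \<zeta>)))"
    using ne by simp
  finally have "exp (- vertex_op z (S \<zeta>) t) = exp (- (Ln ((z + \<zeta>) / (z - \<zeta>)) + vertex_op z (S_tilde S \<zeta>) t))"
    unfolding op by (simp only: exp_minus exp_add mult.commute)
  then show "exp (- vertex_op z (S \<zeta>) t)
          = (momentum S z t - momentum S \<zeta> t) / (momentum S z t + momentum S \<zeta> t)"
    using vertex_identity[OF t z(1) ne(3,4)] by simp
qed

lemma momentum_odd:
  assumes "t \<in> T"
  shows "momentum S (- z) t = - momentum S z t"
proof -
  have "pd 0 (S (- z)) t = pd 0 (\<lambda>t. - S z t) t"
    by (rule pd_cong[OF times_open assms]) (rule S_odd)
  also have "\<dots> = - pd 0 (S z) t"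
    unfolding pd_def[of 0 "\<lambda>t. - S z t"]
    by (intro DERIV_imp_deriv DERIV_minus times_holomorphic_derivative[OF S_holomorphic_times assms])
  finally show ?thesis by (simp add: momentum_def)
qed

text \<open>An exponential never vanishes. Since division by zero yields zero, this excludes a zero
  of the denominator as well as of the numerator.\<close>

lemma momentum_distinct:
  assumes t: "t \<in> T" and z: "1 < norm z1" "z \<noteq> z1" "z \<noteq> - z1"
  shows "momentum S z1 t \<noteq> momentum S z t" "momentum S z1 t + momentum S z t \<noteq> 0"
proof -
  have "(momentum S z1 t - momentum S z t) / (momentum S z1 t + momentum S z t) \<noteq> 0"
    unfolding vertex_identity[OF t z] by simp
  then show "momentum S z1 t \<noteq> momentum S z t" "momentum S z1 t + momentum S z t \<noteq> 0" by auto
qed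

text \<open>Oddness gives momentum zero at \<open>z = 0\<close>, and no point outside the unit disc
  shares the momentum of another point \<open>0 \<noteq> z\<close>.\<close>

lemma momentum_nonzero:
  assumes t: "t \<in> T" and z: "1 < norm z"
  shows "momentum S z t \<noteq> 0"
proof -
  have "momentum S 0 t = 0" using momentum_odd[OF t, of 0] by simp
  then show ?thesis using momentum_distinct(1)[OF t z, of 0] z by (cases "z = 0") auto
qed

text \<open>Equal momenta at distinct points leave only the case \<open>z = - z1\<close>, in which
  oddness would force the momentum to vanish.\<close>

lemma momentum_inj:
  assumes t: "t \<in> T"
  shows "inj_on (\<lambda>z. momentum S z t) (exterior 1)"
proof (rule inj_onI, rule ccontr)
  fix z1 z assume *: "z1 \<in> exterior 1" "z \<in> exterior 1" "momentum S z1 t = momentum S z t" "z1 \<noteq> z"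
  then have z1: "1 < norm z1" by (simp add: exterior_def)
  have "z = - z1"
    using momentum_distinct(1)[OF t z1, of z] * by auto
  then have "momentum S z1 t = - momentum S z1 t" using * momentum_odd[OF t] by simp
  then show False using momentum_nonzero[OF t z1] by simp
qed

lemma momentum_differentiable:
  assumes "t \<in> T"
  shows "(\<lambda>x. momentum S z (t(n := x))) field_differentiable at (t n)"
  unfolding momentum_eq_pd by (rule pd_differentiable_and_commute(1)[OF times_open S_holomorphic_times assms])

lemma S_joint_continuous_on: "continuous_on (UNIV \<times> {x. t(0 := x) \<in> T}) (\<lambda>(z, x). S z (t(0 := x)))"
  unfolding continuous_on_iff
proof (intro ballI allI impI)
  fix q :: "complex \<times> complex" and e :: real
  assume q: "q \<in> UNIV \<times> {x. t(0 := x) \<in> T}" and e: "0 < e"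
  obtain z x where zx: "q = (z, x)" "t(0 := x) \<in> T" using q by auto
  obtain \<delta> where \<delta>: "0 < \<delta>"
    "\<And>z' t'. z' \<in> ball z \<delta> \<Longrightarrow> t' \<in> finite_nbhd {0} \<delta> (t(0 := x)) \<inter> T \<Longrightarrow> dist (S z' t') (S z (t(0 := x))) < e"
    using S_jointly_continuous[OF zx(2) _ e, of "{0}" z] by auto
  show "\<exists>d>0. \<forall>q'\<in>UNIV \<times> {x. t(0 := x) \<in> T}. dist q' q < d \<longrightarrow>
      dist (case q' of (z, x) \<Rightarrow> S z (t(0 := x))) (case q of (z, x) \<Rightarrow> S z (t(0 := x))) < e"
  proof (intro exI[of _ \<delta>] conjI ballI impI \<delta>(1))
    fix q' :: "complex \<times> complex"
    assume q': "q' \<in> UNIV \<times> {x. t(0 := x) \<in> T}" "dist q' q < \<delta>"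
    obtain z' x' where zx': "q' = (z', x')" "t(0 := x') \<in> T" using q' by auto
    have "dist z' z < \<delta>" "dist x' x < \<delta>"
      using q'(2) dist_fst_le[of q' q] dist_snd_le[of q' q] by (auto simp: zx zx')
    then show "dist (case q' of (z, x) \<Rightarrow> S z (t(0 := x))) (case q of (z, x) \<Rightarrow> S z (t(0 := x))) < e"
      using \<delta>(2)[of z' "t(0 := x')"] zx' zx by (auto simp: finite_nbhd_def dist_commute)
  qed
qed

end

section \<open>The tau-function and bounds that are locally uniform in x\<close>

locale dBKP_tau = dBKP_solution +
  fixes F
  assumes tau: "tau_function T S F"
begin

lemma F_holomorphic: "times_holomorphic T F"
  using tau by (simp add: tau_function_def)

lemma F_vertex_summable: "t \<in> T \<Longrightarrow> 1 < norm z \<Longrightarrow> vertex_summable z F t"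
  using tau by (simp add: tau_function_def)

lemma S_tilde_F: "t \<in> T \<Longrightarrow> 1 < norm z \<Longrightarrow> S_tilde S z t = - vertex_op z F t"
  using tau by (simp add: tau_function_def)

text \<open>On the circle the vertex series of \<open>F\<close> equals \<open>- S_tilde\<close>,
  which is jointly continuous in \<open>(z, x)\<close> on a compact set and hence bounded.\<close>

lemma F_vertex_bounded:
  assumes t: "t \<in> T" and \<rho>: "1 < \<rho>"
  obtains d M where "vertex_bounded T F t 1 \<rho> d M"
proof -
  obtain d where d: "0 < d" "\<And>x. x \<in> cball (t 0) d \<Longrightarrow> t(0 := x) \<in> T"
    using finitely_open_line[OF times_open t] by blast
  define K where "K = sphere (0::complex) \<rho> \<times> cball (t 0) d"
  \<comment> \<open>The part \<open>S0\<close> is eliminated through the base point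
    \<open>t\<close>: \<open>S_tilde S z t\<close> is analytic in \<open>z\<close>, and the
    remaining terms are jointly continuous.\<close>
  have "S_tilde S z (t(0 := x)) = S z (t(0 := x)) - S z t + S_tilde S z t - (x - t 0) * z" for z x
    using S_update[OF t, of z 0 x] by (simp add: S_tilde_def algebra_simps)
  moreover have "continuous_on K (\<lambda>q. S (fst q) (t(0 := snd q)))"
  proof -
    have "K \<subseteq> UNIV \<times> {x. t(0 := x) \<in> T}" using d(2) by (auto simp: K_def)
    from continuous_on_subset[OF S_joint_continuous_on this] show ?thesis by (simp add: case_prod_beta)
  qed
  moreover have "continuous_on K (\<lambda>q. S (fst q) (t(0 := t 0)))"
  proof -
    have "continuous_on K ((\<lambda>(z, x). S z (t(0 := x))) \<circ> (\<lambda>q. (fst q, t 0)))"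
      by (intro continuous_on_compose continuous_intros continuous_on_subset[OF S_joint_continuous_on[of t]])
        (use t in auto)
    then show ?thesis by (simp add: o_def)
  qed
  moreover have "continuous_on K (\<lambda>q. S_tilde S (fst q) t)"
  proof -
    have "continuous_on {z. 1 < norm z} (\<lambda>z. S_tilde S z t)"
      using S_tilde_analytic[OF t] analytic_imp_holomorphic holomorphic_on_imp_continuous_on by blast
    then show ?thesis
      by (rule continuous_on_compose2) (use \<rho> in \<open>auto simp: K_def intro!: continuous_intros\<close>)
  qed
  ultimately have "continuous_on K (\<lambda>q. S_tilde S (fst q) (t(0 := snd q)))"
    by (simp add: continuous_intros)
  moreover have "compact K" unfolding K_def by (intro compact_Times) auto
  ultimately have "bounded ((\<lambda>q. S_tilde S (fst q) (t(0 := snd q))) ` K)"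
    by (intro compact_imp_bounded compact_continuous_image)
  then obtain M where M: "\<And>q. q \<in> K \<Longrightarrow> norm (S_tilde S (fst q) (t(0 := snd q))) \<le> M"
    by (auto simp: bounded_iff)
  show thesis
  proof (rule that[of d M], unfold_locales)
    show "norm (vertex_op z F (t(0 := x))) \<le> M" if "x \<in> ball (t 0) d" "norm z = \<rho>" for x z
      using M[of "(z, x)"] S_tilde_F[OF d(2), of x z] that \<rho> by (auto simp: K_def)
  qed (use d \<rho> times_open F_holomorphic F_vertex_summable in auto)
qed

text \<open>Termwise differentiation in \<open>x\<close> of \<open>S = S0 - vertex_op z F\<close>,
  where \<open>S0\<close> contributes the summand \<open>z\<close>. The radius \<open>\<rho>\<close>
  only has to separate \<open>z\<close> from the unit circle.\<close>

lemma momentum_F: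
  assumes t: "t \<in> T" and z: "1 < norm z"
  shows "vertex_summable z (pd 0 F) t" "momentum S z t = z - vertex_op z (pd 0 F) t"
proof -
  define \<rho> where "\<rho> = (1 + norm z) / 2"
  have gt: "1 < \<rho>" "\<rho> < norm z" using z by (auto simp: \<rho>_def)
  obtain d M where "vertex_bounded T F t 1 \<rho> d M" using F_vertex_bounded[OF t gt(1)] .
  then interpret vertex_bounded T F t 1 \<rho> d M .
  have t0: "t 0 \<in> ball (t 0) d" using d by simp
  show "vertex_summable z (pd 0 F) t" using vertex_op_derivative(1)[OF t0 gt(2)] by simp
  have 1: "((\<lambda>x. vertex_op z F (t(0 := x))) has_field_derivative vertex_op z (pd 0 F) t) (at (t 0))"
    using vertex_op_derivative(2)[OF t0 gt(2)] by simp
  have "((\<lambda>x. - vertex_op z F (t(0 := x)) + (S0 z t + (x - t 0) * z)) has_field_derivative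
      z - vertex_op z (pd 0 F) t) (at (t 0))"
    by (rule derivative_eq_intros 1 refl | simp)+
  moreover have "- vertex_op z F (t(0 := x)) + (S0 z t + (x - t 0) * z) = S z (t(0 := x))"
    if "x \<in> ball (t 0) d" for x
    using S_update[OF t, of z 0 x] S_tilde_F[OF inT[OF that] z] by simp
  ultimately have "((\<lambda>x. S z (t(0 := x))) has_field_derivative z - vertex_op z (pd 0 F) t) (at (t 0))"
    by (rule has_field_derivative_transform_within_open[OF _ open_ball t0])
  then show "momentum S z t = z - vertex_op z (pd 0 F) t"
    unfolding momentum_def pd_def by (rule DERIV_imp_deriv)
qed

lemma momentum_holomorphic:
  assumes t: "t \<in> T"
  shows "(\<lambda>z. momentum S z t) holomorphic_on exterior 1"
proof -
  have "(\<lambda>z. z - vertex_op z (pd 0 F) t) holomorphic_on exterior 1"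
    using momentum_F(1)[OF t] by (intro holomorphic_intros vertex_op_holomorphic) auto
  then show ?thesis
    by (rule holomorphic_transform) (use momentum_F(2)[OF t] in \<open>auto simp: exterior_def\<close>)
qed

lemma momentum_joint_continuous:
  assumes t: "t \<in> T" and gt: "1 < \<rho>"
  obtains d where "0 < d" "\<And>x. x \<in> cball (t 0) d \<Longrightarrow> t(0 := x) \<in> T"
    "continuous_on ({z. \<rho> \<le> norm z} \<times> cball (t 0) d) (\<lambda>q. momentum S (fst q) (t(0 := snd q)))"
proof -
  define \<rho>1 where "\<rho>1 = (1 + \<rho>) / 2"
  have \<rho>1: "1 < \<rho>1" "\<rho>1 < \<rho>" using gt by (auto simp: \<rho>1_def)
  obtain d M where "vertex_bounded T F t 1 \<rho>1 d M" using F_vertex_bounded[OF t \<rho>1(1)] .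
  then interpret vertex_bounded T F t 1 \<rho>1 d M .
  have sub: "cball (t 0) (d / 2) \<subseteq> ball (t 0) d" using d by auto
  show thesis
  proof (rule that[of "d / 2"])
    let ?A = "{z::complex. \<rho> \<le> norm z} \<times> cball (t 0) (d / 2)"
    have "continuous_on ?A (\<lambda>q. fst q - (\<lambda>(z, x). vertex_op z (pd 0 F) (t(0 := x))) q)"
      by (intro continuous_intros vertex_op_pd_continuous \<rho>1(2))
    moreover have "fst q - (\<lambda>(z, x). vertex_op z (pd 0 F) (t(0 := x))) q = momentum S (fst q) (t(0 := snd q))"
      if "q \<in> ?A" for q
    proof -
      have "1 < norm (fst q)" "snd q \<in> ball (t 0) d" using that sub gt by auto
      then show ?thesis using momentum_F(2)[OF inT, of "snd q" "fst q"] by (simp add: case_prod_beta)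
    qed
    ultimately show "continuous_on ?A (\<lambda>q. momentum S (fst q) (t(0 := snd q)))"
      by (rule continuous_on_eq)
  qed (use d sub inT in auto)
qed

text \<open>On a circle of radius \<open>\<rho>1\<close> between \<open>R\<close> and
  \<open>\<rho>\<close>, the exponentials of plus and minus the vertex series are a quotient of
  momenta and its inverse. Both are continuous on a compact set, hence bounded, and
  \<open>holomorphic_log_bound\<close> in \<open>w = 1 / z\<close> transfers this to the series
  itself on the smaller circle \<open>norm w = 1 / \<rho>\<close>.\<close>

lemma S_vertex_bounded:
  assumes t: "t \<in> T" and R: "1 \<le> R" "norm \<zeta> \<le> R" "R < \<rho>"
  obtains d M where "vertex_bounded T (S \<zeta>) t R \<rho> d M"
proof -
  define \<rho>1 where "\<rho>1 = (R + \<rho>) / 2"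
  have \<rho>1: "R < \<rho>1" "\<rho>1 < \<rho>" using R by (auto simp: \<rho>1_def)
  obtain d where d: "0 < d" "\<And>x. x \<in> cball (t 0) d \<Longrightarrow> t(0 := x) \<in> T"
    and cont: "continuous_on ({z. \<rho>1 \<le> norm z} \<times> cball (t 0) d) (\<lambda>q. momentum S (fst q) (t(0 := snd q)))"
    using momentum_joint_continuous[OF t, of \<rho>1] R \<rho>1 by auto
  define K where "K = sphere (0::complex) \<rho>1 \<times> cball (t 0) d"
  have c1: "continuous_on K (\<lambda>q. momentum S (fst q) (t(0 := snd q)))"
    by (rule continuous_on_subset[OF cont]) (auto simp: K_def)
  have c2: "continuous_on K (\<lambda>q. momentum S \<zeta> (t(0 := snd q)))"
  proof -
    have "continuous_on (cball (t 0) d) (\<lambda>x. momentum S \<zeta> (t(0 := x)))"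
    proof (intro continuous_at_imp_continuous_on ballI)
      fix x assume "x \<in> cball (t 0) d"
      from momentum_differentiable[OF d(2)[OF this], of \<zeta> 0]
      show "isCont (\<lambda>x. momentum S \<zeta> (t(0 := x))) x"
        using field_differentiable_imp_continuous_at by fastforce
    qed
    then show ?thesis
      by (rule continuous_on_compose2) (auto simp: K_def intro!: continuous_intros)
  qed
  have ne: "momentum S (fst q) (t(0 := snd q)) - momentum S \<zeta> (t(0 := snd q)) \<noteq> 0"
    "momentum S (fst q) (t(0 := snd q)) + momentum S \<zeta> (t(0 := snd q)) \<noteq> 0" if q: "q \<in> K" for q
  proof -
    have q': "t(0 := snd q) \<in> T" "norm (fst q) = \<rho>1" using q d(2) by (auto simp: K_def)
    then have "\<zeta> \<noteq> fst q" "\<zeta> \<noteq> - fst q" using R \<rho>1 by auto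
    with q' show "momentum S (fst q) (t(0 := snd q)) - momentum S \<zeta> (t(0 := snd q)) \<noteq> 0"
      "momentum S (fst q) (t(0 := snd q)) + momentum S \<zeta> (t(0 := snd q)) \<noteq> 0"
      using momentum_distinct[of "t(0 := snd q)" "fst q" \<zeta>] R \<rho>1 by auto
  qed
  let ?G = "\<lambda>q. (momentum S (fst q) (t(0 := snd q)) - momentum S \<zeta> (t(0 := snd q)))
      / (momentum S (fst q) (t(0 := snd q)) + momentum S \<zeta> (t(0 := snd q)))"
  have comp: "compact K" unfolding K_def by (intro compact_Times) auto
  \<comment> \<open>Pairing the quotient with its inverse yields one constant for both.\<close>
  have "continuous_on K (\<lambda>q. (?G q, inverse (?G q)))"
    by (intro continuous_intros c1 c2) (use ne in auto)
  then have "bounded ((\<lambda>q. (?G q, inverse (?G q))) ` K)"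
    by (intro compact_imp_bounded compact_continuous_image comp)
  then obtain M where M': "\<And>q. q \<in> K \<Longrightarrow> norm (?G q, inverse (?G q)) \<le> M"
    by (auto simp: bounded_iff)
  have M: "norm (?G q) \<le> M" "norm (inverse (?G q)) \<le> M" if "q \<in> K" for q
    using M'[OF that] norm_fst_le[of "?G q" "inverse (?G q)"] norm_snd_le[of "inverse (?G q)" "?G q"]
    by (auto intro: order_trans)
  have summ: "vertex_summable z (S \<zeta>) (t(0 := x))" if "x \<in> ball (t 0) d" "R < norm z" for x z
    using vertex_S(1)[OF d(2), of x z \<zeta>] that R by auto
  show thesis
  proof (rule that[of d "M * M / (1 / \<rho>1 - 1 / \<rho>) * (1 / \<rho>)"], unfold_locales)
    show "norm (vertex_op z (S \<zeta>) (t(0 := x))) \<le> M * M / (1 / \<rho>1 - 1 / \<rho>) * (1 / \<rho>)"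
      if x: "x \<in> ball (t 0) d" and z: "norm z = \<rho>" for x z
    proof -
      have "norm (vertex_op (inverse (inverse z)) (S \<zeta>) (t(0 := x))) \<le> M * M / (1 / \<rho>1 - 1 / \<rho>) * (1 / \<rho>)"
      proof (rule holomorphic_log_bound[where K = "\<lambda>w. vertex_op (inverse w) (S \<zeta>) (t(0 := x))"
            and r = "1 / \<rho>1" and ?r2.0 = "1 / R"])
        show "(\<lambda>w. vertex_op (inverse w) (S \<zeta>) (t(0 := x))) holomorphic_on ball 0 (1 / R)"
          by (rule vertex_series_holomorphic) (use R summ x in auto)
        have ex: "exp (- vertex_op (inverse w) (S \<zeta>) (t(0 := x))) = ?G (inverse w, x)" "(inverse w, x) \<in> K"
          if "norm w = 1 / \<rho>1" for w
        proof -
          have n: "norm (inverse w) = \<rho>1" using that by (simp add: norm_inverse norm_divide)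
          then show "(inverse w, x) \<in> K" using x by (simp add: K_def)
          show "exp (- vertex_op (inverse w) (S \<zeta>) (t(0 := x))) = ?G (inverse w, x)"
            using vertex_S(2)[OF d(2), of x "inverse w" \<zeta>] x n R \<rho>1 by simp
        qed
        show "norm (exp (- vertex_op (inverse w) (S \<zeta>) (t(0 := x)))) \<le> M" if "norm w = 1 / \<rho>1" for w
          unfolding ex(1)[OF that] by (rule M(1)[OF ex(2)[OF that]])
        show "norm (exp (vertex_op (inverse w) (S \<zeta>) (t(0 := x)))) \<le> M" if "norm w = 1 / \<rho>1" for w
        proof -
          have "exp (vertex_op (inverse w) (S \<zeta>) (t(0 := x))) = inverse (?G (inverse w, x))"
            unfolding ex(1)[OF that, symmetric] by (simp add: exp_minus)
          then show ?thesis using M(2)[OF ex(2)[OF that]] by simp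
        qed
        show "0 < 1 / \<rho>" "1 / \<rho> < 1 / \<rho>1" "1 / \<rho>1 < 1 / R"
          using R \<rho>1 by (auto intro!: divide_strict_left_mono)
        show "vertex_op (inverse 0) (S \<zeta>) (t(0 := x)) = 0" by (simp add: vertex_op_zero)
        show "norm (inverse z) \<le> 1 / \<rho>" using z by (simp add: norm_inverse norm_divide inverse_eq_divide)
      qed
      then show ?thesis by simp
    qed
  qed (use d R times_open S_holomorphic_times summ in auto)
qed

lemma vertex_op_S_derivative:
  assumes t: "t \<in> T" and R: "1 \<le> R" "norm \<zeta> \<le> R" "R < norm z"
  shows "vertex_summable z (momentum S \<zeta>) t"
    and "((\<lambda>x. vertex_op z (S \<zeta>) (t(0 := x))) has_field_derivative vertex_op z (momentum S \<zeta>) t) (at (t 0))"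
proof -
  define \<rho> where "\<rho> = (R + norm z) / 2"
  have gt: "R < \<rho>" "\<rho> < norm z" using R by (auto simp: \<rho>_def)
  obtain d M where "vertex_bounded T (S \<zeta>) t R \<rho> d M" using S_vertex_bounded[OF t R(1,2) gt(1)] .
  then interpret vertex_bounded T "S \<zeta>" t R \<rho> d M .
  have t0: "t 0 \<in> ball (t 0) d" using d by simp
  show "vertex_summable z (momentum S \<zeta>) t"
    "((\<lambda>x. vertex_op z (S \<zeta>) (t(0 := x))) has_field_derivative vertex_op z (momentum S \<zeta>) t) (at (t 0))"
    using vertex_op_derivative[OF t0 gt(2)] by (auto simp: momentum_eq_pd)
qed

end

subsection \<open>Branches of the logarithm vanishing at infinity\<close>

lemma open_exterior: "open (exterior R)"
  unfolding exterior_def by (intro open_Collect_less continuous_intros)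

lemma connected_exterior: "connected (exterior R)"
proof -
  have "exterior R = - cball 0 R" by (auto simp: exterior_def)
  then show ?thesis by (simp add: connected_complement_bounded_convex)
qed

lemma eventually_in_exterior: "\<forall>\<^sub>F z in at_infinity. z \<in> exterior R"
  unfolding eventually_at_infinity
  by (rule exI[of _ "R + 1"]) (auto simp: exterior_def)

text \<open>The identity theorem: agreement near infinity is agreement on a nonempty open exterior
  domain inside the connected set \<open>\<Omega>\<close>.\<close>

lemma holomorphic_eq_if_eventually_eq:
  assumes "open \<Omega>" "connected \<Omega>" "f holomorphic_on \<Omega>" "g holomorphic_on \<Omega>"
    and ev: "\<forall>\<^sub>F z in at_infinity. z \<in> \<Omega> \<and> f z = g z" and z: "z \<in> \<Omega>"
  shows "f z = g z"
proof -
  obtain b where b: "\<And>z. b \<le> norm z \<Longrightarrow> z \<in> \<Omega> \<and> f z = g z"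
    using ev unfolding eventually_at_infinity by blast
  have "of_real (\<bar>b\<bar> + 1) \<in> exterior b" by (simp add: exterior_def)
  then have "exterior b \<noteq> {}" by blast
  moreover have "exterior b \<subseteq> \<Omega>" using b by (auto simp: exterior_def)
  moreover have "f z = g z" if "z \<in> exterior b" for z using b that by (auto simp: exterior_def)
  ultimately show ?thesis
    using analytic_continuation_open[OF open_exterior \<open>open \<Omega>\<close> _ \<open>connected \<Omega>\<close>] assms by blast
qed

text \<open>Near infinity the two branches differ by less than 1, while having equal exponentials
  they differ by a multiple of \<open>2 * pi * \<i>\<close>. The domains may differ, which allows
  branches belonging to two solutions of the Sato relation to be compared.\<close>

lemma log_branch_eventually_eq:
  assumes "log_branch \<Omega> f L" "log_branch \<Omega>' f L'"
  shows "\<forall>\<^sub>F q in at_infinity. L q = L' q"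
proof -
  have "((\<lambda>q. L q - L' q) \<longlongrightarrow> 0 - 0) at_infinity"
    using assms by (intro tendsto_diff) (auto simp: log_branch_def)
  then have "\<forall>\<^sub>F q in at_infinity. dist (L q - L' q) 0 < 1"
    by (auto dest: tendstoD[where e = 1])
  moreover have "\<forall>\<^sub>F q in at_infinity. q \<in> \<Omega>" "\<forall>\<^sub>F q in at_infinity. q \<in> \<Omega>'"
    using assms by (auto simp: log_branch_def)
  ultimately show ?thesis
  proof eventually_elim
    case (elim q)
    have "exp (L q) = exp (L' q)" using assms elim by (auto simp: log_branch_def)
    moreover have "\<bar>Im (L q) - Im (L' q)\<bar> < 2 * pi"
      using abs_Im_le_cmod[of "L q - L' q"] elim pi_gt3 by simp
    ultimately show ?case by (rule exp_complex_eqI[rotated])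
  qed
qed

lemma log_branch_unique:
  assumes L: "log_branch \<Omega> f L" "log_branch \<Omega> f L'" and q: "q \<in> \<Omega>"
  shows "L q = L' q"
proof (rule holomorphic_eq_if_eventually_eq[OF _ _ _ _ _ q])
  show "\<forall>\<^sub>F q in at_infinity. q \<in> \<Omega> \<and> L q = L' q"
    using L(1) log_branch_eventually_eq[OF L] by (auto simp: log_branch_def eventually_conj)
qed (use L in \<open>auto simp: log_branch_def\<close>)

lemma log_branch_log_inf: "has_log \<Omega> f \<Longrightarrow> log_branch \<Omega> f (log_inf \<Omega> f)"
  unfolding has_log_def log_inf_def by (rule someI_ex[of "log_branch \<Omega> f"])

lemma log_inf_eq:
  assumes "log_branch \<Omega> f L" "q \<in> \<Omega>"
  shows "log_inf \<Omega> f q = L q"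
  using assms log_branch_unique log_branch_log_inf unfolding has_log_def by blast

lemma log_branch_ratio2:
  assumes "log_branch \<Omega> (ratio1 a) L" "log_branch \<Omega> (ratio1 b) L'"
  shows "log_branch \<Omega> (ratio2 a b) (\<lambda>q. L q - L' q)"
proof -
  have "((\<lambda>q. L q - L' q) \<longlongrightarrow> 0 - 0) at_infinity"
    using assms by (intro tendsto_diff) (auto simp: log_branch_def)
  moreover have "exp (L q - L' q) = ratio2 a b q" if "q \<in> \<Omega>" for q
  proof -
    have "exp (L q - L' q) = ratio1 a q / ratio1 b q"
      using assms that by (simp add: exp_diff log_branch_def)
    then show ?thesis by (simp add: ratio1_def ratio2_def)
  qed
  ultimately show ?thesis
    using assms by (auto simp: log_branch_def intro!: holomorphic_intros)
qed

subsection \<open>The momentum near infinity\<close>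

lemma vertex_op_tendsto_0:
  assumes "0 < R" "\<And>z. R < norm z \<Longrightarrow> vertex_summable z f t"
  shows "((\<lambda>z. vertex_op z f t) \<longlongrightarrow> 0) at_infinity"
proof -
  have "isCont (\<lambda>w. vertex_op (inverse w) f t) 0"
    using holomorphic_on_imp_continuous_on[OF vertex_series_holomorphic[OF assms]] assms(1)
    by (simp add: continuous_on_eq_continuous_at)
  then have "((\<lambda>z. vertex_op (inverse (inverse z)) f t) \<longlongrightarrow> vertex_op (inverse 0) f t) at_infinity"
    by (rule isCont_tendsto_compose) (rule tendsto_inverse_0)
  then show ?thesis by (simp add: vertex_op_zero)
qed

context dBKP_tau
begin

lemma momentum_filterlim:
  assumes t: "t \<in> T"
  shows "filterlim (\<lambda>z. momentum S z t) at_infinity at_infinity"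
proof -
  have "((\<lambda>z. - vertex_op z (pd 0 F) t) \<longlongrightarrow> - 0) at_infinity"
    by (intro tendsto_minus vertex_op_tendsto_0[of 1] momentum_F(1)[OF t]) auto
  then have "filterlim (\<lambda>z. z + - vertex_op z (pd 0 F) t) at_infinity at_infinity"
    by (intro tendsto_add_filterlim_at_infinity'[OF filterlim_ident])
  then show ?thesis
  proof (rule filterlim_cong[THEN iffD1, OF refl refl, rotated])
    show "\<forall>\<^sub>F z in at_infinity. z + - vertex_op z (pd 0 F) t = momentum S z t"
      using eventually_in_exterior[of 1]
      by eventually_elim (use momentum_F(2)[OF t] in \<open>auto simp: exterior_def\<close>)
  qed
qed

text \<open>In the coordinate \<open>w = 1 / z\<close> at infinity, \<open>1 / p\<close> extends to a holomorphic function
  vanishing at \<open>w = 0\<close> only, so the open mapping theorem applies there.\<close>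

lemma momentum_onto_near_infinity:
  assumes t: "t \<in> T" and B: "1 \<le> B"
  shows "\<forall>\<^sub>F q in at_infinity. \<exists>z. B < norm z \<and> q = momentum S z t"
proof -
  define V where "V = (\<lambda>w. vertex_op (inverse w) (pd 0 F) t)"
  define g where "g = (\<lambda>w. 1 - w * V w)"
  have holV: "V holomorphic_on ball 0 1"
    unfolding V_def using vertex_series_holomorphic[of 1 "pd 0 F" t] momentum_F(1)[OF t] by simp
  have gp: "g w = w * momentum S (inverse w) t" if "w \<in> ball 0 1" "w \<noteq> 0" for w
  proof -
    have "1 < norm (inverse w)" using that by (simp add: norm_inverse one_less_inverse_iff)
    from momentum_F(2)[OF t this] that(2) show ?thesis by (simp add: g_def V_def right_diff_distrib)
  qed
  have g0: "g w \<noteq> 0" if "w \<in> ball 0 1" for w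
  proof (cases "w = 0")
    case False
    then have "1 < norm (inverse w)" using that by (simp add: norm_inverse one_less_inverse_iff)
    then show ?thesis using gp[OF that False] momentum_nonzero[OF t] False by auto
  qed (simp add: g_def)
  \<comment> \<open>This is \<open>1 / p(1 / w)\<close>, continued by 0 to \<open>w = 0\<close>. It
    is not constant, since it vanishes at 0 but not at \<open>1 / 2\<close>.\<close>
  define Q where "Q = (\<lambda>w. w / g w)"
  have holQ: "Q holomorphic_on ball 0 1"
    unfolding Q_def g_def by (intro holomorphic_intros holV) (use g0 in \<open>auto simp: g_def\<close>)
  have "open (Q ` ball 0 (1 / B))"
  proof (rule open_mapping_thm[OF holQ])
    show "ball 0 (1 / B) \<subseteq> ball (0::complex) 1" using B by (intro subset_ball) simp
    show "\<not> Q constant_on ball 0 1"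
    proof
      assume "Q constant_on ball 0 1"
      then have "Q (1 / 2) = Q 0" by (auto simp: constant_on_def)
      then show False using g0[of "1 / 2"] by (simp add: Q_def)
    qed
  qed auto
  moreover have "0 \<in> Q ` ball 0 (1 / B)" using B by (auto simp: Q_def intro!: image_eqI[of _ _ 0])
  ultimately obtain \<epsilon> where \<epsilon>: "0 < \<epsilon>" "ball 0 \<epsilon> \<subseteq> Q ` ball 0 (1 / B)"
    by (meson open_contains_ball)
  have "\<exists>z. B < norm z \<and> q = momentum S z t" if q: "q \<in> exterior (1 / \<epsilon>)" for q
  proof -
    have "norm (inverse q) < 1 / (1 / \<epsilon>)"
      using norm_inverse_less[of "1 / \<epsilon>" q] \<epsilon> q by (simp add: exterior_def)
    then have "inverse q \<in> Q ` ball 0 (1 / B)" using \<epsilon> by auto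
    then obtain w where w: "w \<in> ball 0 (1 / B)" "inverse q = Q w" by blast
    have "q \<noteq> 0" using q \<epsilon> by (auto simp: exterior_def)
    then have "w \<noteq> 0" using w by (auto simp: Q_def)
    have "1 / B \<le> 1" using B by simp
    then have w1: "w \<in> ball 0 1" using w by auto
    have "q = inverse (Q w)" using w(2) by (metis inverse_inverse_eq)
    also have "\<dots> = momentum S (inverse w) t"
      using gp[OF w1 \<open>w \<noteq> 0\<close>] \<open>w \<noteq> 0\<close> by (simp add: Q_def field_simps)
    finally have "q = momentum S (inverse w) t" .
    moreover have "B < norm (inverse w)"
    proof -
      have "inverse (1 / B) < inverse (norm w)"
        using w(1) \<open>w \<noteq> 0\<close> B by (intro less_imp_inverse_less) auto
      then show ?thesis by (simp add: norm_inverse)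
    qed
    ultimately show ?thesis by blast
  qed
  then show ?thesis using eventually_in_exterior[of "1 / \<epsilon>"] by (auto elim: eventually_mono)
qed

text \<open>\<open>Z\<close> is the inverse of the momentum on \<open>exterior R\<close>. By the
  vertex identity \<open>- vertex_op (Z q) (S \<zeta>) t\<close> is a logarithm of
  \<open>ratio1\<close> in the variable \<open>q\<close>; it vanishes at infinity because
  \<open>Z q\<close> tends to infinity there.\<close>

lemma momentum_log_branch:
  assumes t: "t \<in> T" and R: "1 \<le> R"
  obtains Z where "\<And>z. z \<in> exterior R \<Longrightarrow> Z (momentum S z t) = z"
    "\<And>\<zeta>. norm \<zeta> \<le> R \<Longrightarrow>
       log_branch ((\<lambda>z. momentum S z t) ` exterior R) (ratio1 (momentum S \<zeta> t)) (\<lambda>q. - vertex_op (Z q) (S \<zeta>) t)"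
proof -
  define P where "P = (\<lambda>z. momentum S z t)"
  have sub: "exterior R \<subseteq> exterior 1" using R by (auto simp: exterior_def)
  have holP: "P holomorphic_on exterior R"
    unfolding P_def by (rule holomorphic_on_subset[OF momentum_holomorphic[OF t] sub])
  have injP: "inj_on P (exterior R)"
    unfolding P_def by (rule inj_on_subset[OF momentum_inj[OF t] sub])
  obtain Z where Z: "Z holomorphic_on P ` exterior R" "\<And>z. z \<in> exterior R \<Longrightarrow> Z (P z) = z"
    using holomorphic_has_inverse[OF holP open_exterior injP] by metis
  have onto: "\<forall>\<^sub>F q in at_infinity. \<exists>z. B < norm z \<and> q = P z" if "1 \<le> B" for B
    unfolding P_def by (rule momentum_onto_near_infinity[OF t that])
  have op: "open (P ` exterior R)" by (rule open_mapping_thm3[OF holP open_exterior injP])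
  have conn: "connected (P ` exterior R)"
    by (intro connected_continuous_image holomorphic_on_imp_continuous_on holP connected_exterior)
  have ev: "\<forall>\<^sub>F q in at_infinity. q \<in> P ` exterior R"
    using onto[OF R] by eventually_elim (auto simp: exterior_def)
  \<comment> \<open>Every \<open>q\<close> near infinity is the momentum of some \<open>z\<close>
    with \<open>norm z > r\<close> in \<open>exterior R\<close>, and \<open>Z\<close> sends it back
    to that \<open>z\<close>.\<close>
  have Zlim: "filterlim Z at_infinity at_infinity"
    unfolding filterlim_at_infinity[OF order_refl]
  proof (intro allI impI)
    fix r :: real
    have "1 \<le> max r R" using R by simp
    from onto[OF this] show "\<forall>\<^sub>F q in at_infinity. r \<le> norm (Z q)"
      by eventually_elim (use Z(2) in \<open>auto simp: exterior_def\<close>)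
  qed
  have "log_branch (P ` exterior R) (ratio1 (momentum S \<zeta> t)) (\<lambda>q. - vertex_op (Z q) (S \<zeta>) t)"
    if \<zeta>: "norm \<zeta> \<le> R" for \<zeta>
  proof -
    have summ: "vertex_summable z (S \<zeta>) t" if "R < norm z" for z
      using vertex_S(1)[OF t] that R \<zeta> by auto
    have "(\<lambda>z. vertex_op z (S \<zeta>) t) \<circ> Z holomorphic_on P ` exterior R"
      by (rule holomorphic_on_compose_gen[OF Z(1) vertex_op_holomorphic])
        (use R summ Z(2) in auto)
    then have "(\<lambda>q. - vertex_op (Z q) (S \<zeta>) t) holomorphic_on P ` exterior R"
      by (intro holomorphic_intros) (simp add: o_def)
    moreover have "exp (- vertex_op (Z q) (S \<zeta>) t) = ratio1 (momentum S \<zeta> t) q"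
      if q: "q \<in> P ` exterior R" for q
    proof -
      obtain z where z: "z \<in> exterior R" "q = P z" using q by blast
      have "1 < norm z" "norm \<zeta> < norm z" using z R \<zeta> by (auto simp: exterior_def)
      from vertex_S(2)[OF t this] show ?thesis
        using Z(2)[OF z(1)] by (simp add: z(2) P_def ratio1_def)
    qed
    moreover have "((\<lambda>q. - vertex_op (Z q) (S \<zeta>) t) \<longlongrightarrow> - 0) at_infinity"
      by (intro tendsto_minus filterlim_compose[OF vertex_op_tendsto_0[OF _ summ] Zlim]) (use R in auto)
    ultimately show ?thesis
      using op conn ev by (simp add: log_branch_def)
  qed
  then show thesis using that[of Z] Z(2) unfolding P_def by blast
qed

lemma momentum_log_inf:
  assumes t: "t \<in> T" and R: "1 \<le> R" and \<zeta>: "norm \<zeta> \<le> R" "norm \<zeta>' \<le> R"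
  defines "\<Omega> \<equiv> (\<lambda>z. momentum S z t) ` exterior R"
  shows "has_log \<Omega> (ratio1 (momentum S \<zeta> t))"
    and "has_log \<Omega> (ratio2 (momentum S \<zeta> t) (momentum S \<zeta>' t))"
    and "z \<in> exterior R \<Longrightarrow> log_inf \<Omega> (ratio1 (momentum S \<zeta> t)) (momentum S z t) = - vertex_op z (S \<zeta>) t"
    and "z \<in> exterior R \<Longrightarrow> log_inf \<Omega> (ratio2 (momentum S \<zeta> t) (momentum S \<zeta>' t)) (momentum S z t)
        = vertex_op z (S \<zeta>') t - vertex_op z (S \<zeta>) t"
proof -
  obtain Z where Z: "\<And>z. z \<in> exterior R \<Longrightarrow> Z (momentum S z t) = z"
    and L: "\<And>\<zeta>. norm \<zeta> \<le> R \<Longrightarrow> log_branch \<Omega> (ratio1 (momentum S \<zeta> t)) (\<lambda>q. - vertex_op (Z q) (S \<zeta>) t)"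
    using momentum_log_branch[OF t R] unfolding \<Omega>_def by blast
  note L2 = log_branch_ratio2[OF L[OF \<zeta>(1)] L[OF \<zeta>(2)]]
  show "has_log \<Omega> (ratio1 (momentum S \<zeta> t))"
    "has_log \<Omega> (ratio2 (momentum S \<zeta> t) (momentum S \<zeta>' t))"
    using L[OF \<zeta>(1)] L2 by (auto simp: has_log_def)
  assume z: "z \<in> exterior R"
  then have mem: "momentum S z t \<in> \<Omega>" by (simp add: \<Omega>_def)
  show "log_inf \<Omega> (ratio1 (momentum S \<zeta> t)) (momentum S z t) = - vertex_op z (S \<zeta>) t"
    using log_inf_eq[OF L[OF \<zeta>(1)] mem] Z[OF z] by simp
  show "log_inf \<Omega> (ratio2 (momentum S \<zeta> t) (momentum S \<zeta>' t)) (momentum S z t)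
        = vertex_op z (S \<zeta>') t - vertex_op z (S \<zeta>) t"
    using log_inf_eq[OF L2 mem] Z[OF z] by simp
qed

subsection \<open>The first flow\<close>

text \<open>Compares the leading coefficients of two expansions of \<open>S_tilde\<close> at
  infinity, the given one and the one obtained from the tau-function.\<close>

lemma Sc_1:
  assumes t: "t \<in> T"
  shows "Sc 1 t = - 2 * pd 0 F t"
proof -
  \<comment> \<open>For \<open>0 < norm w < 1\<close> this is
    \<open>S_tilde S (inverse w) t / w\<close>; its limit at \<open>w = 0\<close> reads off the
    leading coefficient from either expansion.\<close>
  define f where "f = (\<lambda>w. - vertex_op (inverse w) F t / w)"
  have 1: "(\<lambda>i. Sc (Suc i) t * w ^ i) sums f w" "(\<lambda>i. - vertex_coeff F t (Suc i) * w ^ i) sums f w"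
    if w: "w \<noteq> 0" "norm w < 1" for w
  proof -
    have n: "1 < norm (inverse w)" using w by (simp add: norm_inverse one_less_inverse_iff)
    have "(\<lambda>i. Sc (Suc i) t * w ^ Suc i) sums (- vertex_op (inverse w) F t)"
      using S_tilde_expansion[OF t n] S_tilde_F[OF t n] by (simp add: power_inverse)
    from sums_divide[OF this, of w] show "(\<lambda>i. Sc (Suc i) t * w ^ i) sums f w"
      using w by (simp add: f_def)
    have "(\<lambda>m. vertex_coeff F t m * w ^ m) sums vertex_op (inverse w) F t"
      by (rule vertex_series_sums[OF F_vertex_summable[OF t n]])
    then have "(\<lambda>i. vertex_coeff F t (Suc i) * w ^ Suc i) sums vertex_op (inverse w) F t"
      by (subst sums_Suc_iff) (simp add: vertex_coeff_def)
    from sums_minus[OF sums_divide[OF this, of w]]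
    show "(\<lambda>i. - vertex_coeff F t (Suc i) * w ^ i) sums f w"
      using w by (simp add: f_def)
  qed
  have "(f \<longlongrightarrow> Sc (Suc 0) t) (at 0)"
    by (rule powser_limit_0_strong[of 1 "\<lambda>i. Sc (Suc i) t"]) (use 1 in auto)
  moreover have "(f \<longlongrightarrow> - vertex_coeff F t (Suc 0)) (at 0)"
    by (rule powser_limit_0_strong[of 1 "\<lambda>i. - vertex_coeff F t (Suc i)"]) (use 1 in auto)
  ultimately have "Sc 1 t = - vertex_coeff F t (Suc 0)"
    using tendsto_unique[of "at (0::complex)"] by simp
  then show ?thesis by (simp add: vertex_coeff_def)
qed

text \<open>Identifies \<open>u\<close> with twice the second x-derivative of \<open>F\<close>, the
  form in which it enters the first flow.\<close>

lemma pd_Sc_1: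
  assumes t: "t \<in> T"
  shows "- pd 0 (Sc 1) t = 2 * pd 0 (pd 0 F) t"
proof -
  have "pd 0 (Sc 1) t = pd 0 (\<lambda>t. - 2 * pd 0 F t) t"
    by (rule pd_cong[OF times_open t Sc_1])
  also have "\<dots> = - 2 * pd 0 (pd 0 F) t"
    unfolding pd_def[of 0 "\<lambda>t. - 2 * pd 0 F t"] pd_def[of 0 "pd 0 F"]
    by (intro DERIV_imp_deriv DERIV_cmult field_differentiable_derivI
        pd_differentiable_and_commute(1)[OF times_open F_holomorphic t])
  finally show ?thesis by simp
qed

text \<open>With \<open>g w = w p(1/w)\<close> and \<open>K w = D(1/w) S(\<zeta>)\<close>, the derivative of the vertex identity
  \<open>exp (- K) (g + p w) = g - p w\<close> no longer contains the exponential, and its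
  coefficient of \<open>w\<^sup>2\<close> gives \<open>\<partial>\<^sub>y S\<close>.\<close>

lemma pd_1_S:
  assumes t: "t \<in> T"
  shows "pd 1 (S \<zeta>) t = momentum S \<zeta> t ^ 3 + 3 * momentum S \<zeta> t * (2 * pd 0 (pd 0 F) t)"
proof -
  define R where "R = max 1 (norm \<zeta>)"
  have R: "1 \<le> R" "norm \<zeta> \<le> R" by (auto simp: R_def)
  define p where "p = momentum S \<zeta> t"
  define K where "K = (\<lambda>w. vertex_op (inverse w) (S \<zeta>) t)"
  define V where "V = (\<lambda>w. vertex_op (inverse w) (pd 0 F) t)"
  define g where "g = (\<lambda>w. 1 - w * V w)"
  have summ: "vertex_summable z (S \<zeta>) t" "vertex_summable z (pd 0 F) t" if "R < norm z" for z
    using vertex_S(1)[OF t] momentum_F(1)[OF t] that R by auto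
  have Rpos: "0 < R" using R by simp
  have holK: "K holomorphic_on ball 0 (1 / R)" and holV: "V holomorphic_on ball 0 (1 / R)"
    unfolding K_def V_def by (intro vertex_series_holomorphic Rpos summ; assumption)+
  have holg: "g holomorphic_on ball 0 (1 / R)"
    unfolding g_def by (intro holomorphic_intros holV)
  define KF where "KF = Abs_fps (vertex_coeff (S \<zeta>) t)"
  define VF where "VF = Abs_fps (vertex_coeff (pd 0 F) t)"
  define gF where "gF = 1 - fps_X * VF"
  have fpsK: "K has_fps_expansion KF" and fpsV: "V has_fps_expansion VF"
    unfolding K_def V_def KF_def VF_def by (intro vertex_series_fps[OF Rpos] summ; assumption)+
  have fpsg: "g has_fps_expansion gF"
    unfolding g_def gF_def by (intro fps_expansion_intros fpsV)
  \<comment> \<open>The vertex identity with denominators cleared and multiplied by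
    \<open>w\<close>, which makes it valid at \<open>w = 0\<close> too.\<close>
  have id: "exp (- K w) * (g w + p * w) = g w - p * w" if w: "w \<in> ball 0 (1 / R)" for w
  proof (cases "w = 0")
    case True
    then show ?thesis by (simp add: K_def vertex_op_zero)
  next
    case False
    have n: "R < norm (inverse w)"
      using norm_inverse_less[of "R" "inverse w"] w False R less_imp_inverse_less[of "norm w" "1 / R"]
      by (simp add: norm_inverse)
    have z: "1 < norm (inverse w)" "norm \<zeta> < norm (inverse w)" using n R by auto
    have g: "g w = w * momentum S (inverse w) t"
      using momentum_F(2)[OF t z(1)] False by (simp add: g_def V_def right_diff_distrib)
    have "momentum S (inverse w) t + p \<noteq> 0"
      unfolding p_def by (rule momentum_distinct(2)[OF t z(1)]) (use z in auto)
    then have "exp (- K w) * (momentum S (inverse w) t + p) = momentum S (inverse w) t - p"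
      using vertex_S(2)[OF t z] by (simp add: K_def p_def)
    then show ?thesis unfolding g by algebra
  qed
  have dK: "deriv K w * ((g w)\<^sup>2 - p\<^sup>2 * w\<^sup>2) = 2 * p * (g w - w * deriv g w)"
    if w: "w \<in> ball 0 (1 / R)" for w
  proof -
    have K': "(K has_field_derivative deriv K w) (at w)" and g': "(g has_field_derivative deriv g w) (at w)"
      using holK holg w by (auto intro: holomorphic_derivI)
    have "((\<lambda>w. g w - p * w) has_field_derivative deriv g w - p) (at w)"
      by (rule derivative_eq_intros g' refl | simp)+
    moreover have "((\<lambda>w. exp (- K w) * (g w + p * w)) has_field_derivative
        - deriv K w * (exp (- K w) * (g w + p * w)) + exp (- K w) * (deriv g w + p)) (at w)"
      by (rule derivative_eq_intros g' K' refl | simp)+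
    then have "((\<lambda>w. g w - p * w) has_field_derivative
        - deriv K w * (exp (- K w) * (g w + p * w)) + exp (- K w) * (deriv g w + p)) (at w)"
      by (rule has_field_derivative_transform_within_open[OF _ open_ball w id])
    ultimately have "- deriv K w * (exp (- K w) * (g w + p * w)) + exp (- K w) * (deriv g w + p) = deriv g w - p"
      by (rule DERIV_unique[rotated])
    \<comment> \<open>Multiplying by \<open>g w + p * w\<close> produces the left side of
      \<open>id\<close> once more, so that the remaining exponential can be eliminated.\<close>
    then have "(- deriv K w * (g w - p * w) + exp (- K w) * (deriv g w + p)) * (g w + p * w)
        = (deriv g w - p) * (g w + p * w)"
      unfolding id[OF w] by simp
    then have "- deriv K w * (g w - p * w) * (g w + p * w) + (exp (- K w) * (g w + p * w)) * (deriv g w + p)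
        = (deriv g w - p) * (g w + p * w)"
      by (simp add: algebra_simps)
    then have "- deriv K w * (g w - p * w) * (g w + p * w) + (g w - p * w) * (deriv g w + p)
        = (deriv g w - p) * (g w + p * w)"
      unfolding id[OF w] .
    then show ?thesis by algebra
  qed
  have lhs: "(\<lambda>w. deriv K w * ((g w)\<^sup>2 - p\<^sup>2 * w\<^sup>2)) has_fps_expansion
      fps_deriv KF * (gF * gF - fps_const (p\<^sup>2) * fps_X ^ 2)"
    unfolding power2_eq_square[of "g _"]
    by (intro fps_expansion_intros fpsK fpsg)
  have rhs: "(\<lambda>w. 2 * p * (g w - w * deriv g w)) has_fps_expansion
      fps_const (2 * p) * (gF - fps_X * fps_deriv gF)"
    by (intro fps_expansion_intros fpsg)
  have ev: "\<forall>\<^sub>F w in nhds 0. deriv K w * ((g w)\<^sup>2 - p\<^sup>2 * w\<^sup>2) = 2 * p * (g w - w * deriv g w)"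
  proof -
    have "\<forall>\<^sub>F w in nhds 0. w \<in> ball (0::complex) (1 / R)"
      using Rpos by (intro eventually_nhds_in_open) auto
    then show ?thesis by eventually_elim (rule dK)
  qed
  have eq: "fps_deriv KF * (gF * gF - fps_const (p\<^sup>2) * fps_X ^ 2)
      = fps_const (2 * p) * (gF - fps_X * fps_deriv gF)"
    by (rule fps_expansion_unique_complex[OF _ rhs])
      (rule has_fps_expansion_cong[THEN iffD1, OF ev refl lhs])
  define U where "U = 2 * pd 0 (pd 0 F) t"
  have V: "VF $ 0 = 0" "VF $ 1 = U" "VF $ 2 = 0"
    by (simp_all add: VF_def vertex_coeff_def U_def)
  have gc: "gF $ 0 = 1" "gF $ 1 = 0" "gF $ 2 = - U"
    using V by (simp_all add: gF_def)
  \<comment> \<open>In the last coefficient the factor 3 from differentiating the cubic term cancels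
    the denominator 3 of the vertex series.\<close>
  have Kc: "fps_deriv KF $ 0 = 2 * p" "fps_deriv KF $ 1 = 0" "fps_deriv KF $ 2 = 2 * pd 1 (S \<zeta>) t"
    by (simp_all add: KF_def vertex_coeff_def p_def momentum_def)
  have nth2: "(A * B) $ 2 = A $ 0 * B $ 2 + A $ 1 * B $ 1 + A $ 2 * B $ 0" for A B :: "complex fps"
    by (simp add: fps_mult_nth numeral_2_eq_2)
  have nth1: "(A * B) $ 1 = A $ 0 * B $ 1 + A $ 1 * B $ 0" for A B :: "complex fps"
    by (simp add: fps_mult_nth)
  define H where "H = gF * gF - fps_const (p\<^sup>2) * fps_X ^ 2"
  have H: "H $ 0 = 1" "H $ 1 = 0" "H $ 2 = - 2 * U - p\<^sup>2"
    unfolding H_def fps_sub_nth nth2[of gF] nth1[of gF] gc by (simp_all add: gc)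
  \<comment> \<open>With Y for \<open>pd 1 (S \<zeta>) t\<close>, the coefficients of
    \<open>w\<^sup>2\<close> give \<open>2 * p * (- 2 * U - p\<^sup>2) + 2 * Y = 2 * p * U\<close>,
    hence \<open>Y = p ^ 3 + 3 * p * U\<close>.\<close>
  have "(fps_deriv KF * H) $ 2 = (fps_const (2 * p) * (gF - fps_X * fps_deriv gF)) $ 2"
    unfolding H_def eq ..
  moreover have "(fps_deriv KF * H) $ 2 = 2 * p * (- 2 * U - p\<^sup>2) + 2 * pd 1 (S \<zeta>) t"
    unfolding nth2 H Kc by simp
  moreover have "(fps_const (2 * p) * (gF - fps_X * fps_deriv gF)) $ 2 = 2 * p * U"
  proof -
    have "(fps_X * fps_deriv gF) $ 2 = 2 * gF $ 2" by (simp add: numeral_2_eq_2)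
    then show ?thesis by (simp add: gc)
  qed
  ultimately show ?thesis
    unfolding p_def[symmetric] U_def[symmetric] by algebra
qed

end

subsection \<open>The symmetry constraint\<close>

lemma norm_le_sato_radius:
  assumes "i \<in> {1..N}"
  shows "norm (\<zeta> i) \<le> sato_radius N \<zeta> \<zeta>'" "norm (\<zeta>' i) \<le> sato_radius N \<zeta> \<zeta>'"
  using assms unfolding sato_radius_def by (intro Max_ge; auto)+

lemma one_le_sato_radius: "1 \<le> sato_radius N \<zeta> \<zeta>'"
  unfolding sato_radius_def by (intro Max_ge) auto

locale dBKP_constrained = dBKP_tau +
  fixes N :: nat and c \<zeta> \<zeta>' :: "nat \<Rightarrow> complex"
  assumes constraint: "\<And>t. t \<in> T \<Longrightarrow> pd 0 F t = 1 / 2 * (\<Sum>i=1..N. c i * (S (\<zeta> i) t - S (\<zeta>' i) t))"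
begin

lemma pd_constraint:
  assumes t: "t \<in> T"
  shows "pd n (pd 0 F) t = 1 / 2 * (\<Sum>i=1..N. c i * (pd n (S (\<zeta> i)) t - pd n (S (\<zeta>' i)) t))"
proof -
  have "pd n (pd 0 F) t = pd n (\<lambda>t. 1 / 2 * (\<Sum>i=1..N. c i * (S (\<zeta> i) t - S (\<zeta>' i) t))) t"
    by (rule pd_cong[OF times_open t constraint])
  also have "\<dots> = 1 / 2 * (\<Sum>i=1..N. c i * (pd n (S (\<zeta> i)) t - pd n (S (\<zeta>' i)) t))"
    unfolding pd_def[of n "\<lambda>t. 1 / 2 * (\<Sum>i=1..N. c i * (S (\<zeta> i) t - S (\<zeta>' i) t))"]
    by (intro DERIV_imp_deriv DERIV_cmult DERIV_sum DERIV_diff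
        times_holomorphic_derivative[OF S_holomorphic_times t])
  finally show ?thesis .
qed

lemma constraint_u:
  assumes t: "t \<in> T"
  shows "2 * pd 0 (pd 0 F) t = (\<Sum>i=1..N. c i * (momentum S (\<zeta> i) t - momentum S (\<zeta>' i) t))"
  unfolding pd_constraint[OF t] momentum_def by simp

text \<open>Compatibility of the flows: the y-derivative of the momentum is the x-derivative of
  \<open>pd 1 (S \<xi>)\<close>, into which \<open>pd_1_S\<close> and the constrained value of
  \<open>u\<close> are inserted.\<close>

lemma first_flow:
  assumes t: "t \<in> T"
  shows "pd 1 (momentum S \<xi>) t = pd 0 (\<lambda>t. momentum S \<xi> t ^ 3
    + 3 * momentum S \<xi> t * (\<Sum>i=1..N. c i * (momentum S (\<zeta> i) t - momentum S (\<zeta>' i) t))) t"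
proof -
  have "pd 1 (momentum S \<xi>) t = pd 0 (pd 1 (S \<xi>)) t"
    unfolding momentum_eq_pd by (rule pd_differentiable_and_commute(2)[OF times_open S_holomorphic_times t])
  also have "\<dots> = pd 0 (\<lambda>t. momentum S \<xi> t ^ 3
      + 3 * momentum S \<xi> t * (\<Sum>i=1..N. c i * (momentum S (\<zeta> i) t - momentum S (\<zeta>' i) t))) t"
    by (rule pd_cong[OF times_open t]) (simp only: pd_1_S constraint_u)
  finally show ?thesis .
qed

definition R where "R = sato_radius N \<zeta> \<zeta>'"

lemma R: "1 \<le> R" "i \<in> {1..N} \<Longrightarrow> norm (\<zeta> i) \<le> R" "i \<in> {1..N} \<Longrightarrow> norm (\<zeta>' i) \<le> R"
  unfolding R_def by (rule one_le_sato_radius norm_le_sato_radius; assumption)+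

text \<open>The vertex operator is applied to the constraint by linearity; each series on the right
  converges since \<open>norm z > R\<close> exceeds the moduli of all the points.\<close>

lemma vertex_op_constraint:
  assumes t: "t \<in> T" and z: "z \<in> exterior R"
  shows "vertex_op z (pd 0 F) t
    = 1 / 2 * (\<Sum>i=1..N. c i * (vertex_op z (S (\<zeta> i)) t - vertex_op z (S (\<zeta>' i)) t))"
proof -
  \<comment> \<open>The factor 2 sits outside the sum in \<open>vertex_op\<close>, so the bare terms
    sum to half of it.\<close>
  have sums: "vertex_term z (S \<xi>) t sums (vertex_op z (S \<xi>) t / 2)" if "norm \<xi> \<le> R" for \<xi>
  proof -
    have "vertex_summable z (S \<xi>) t"
      using that z R(1) by (intro vertex_S(1)[OF t]) (auto simp: exterior_def)
    then show ?thesis by (simp add: vertex_summable_def vertex_op_def summable_sums)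
  qed
  have "vertex_term z (pd 0 F) t
      = (\<lambda>n. 1 / 2 * (\<Sum>i=1..N. c i * (vertex_term z (S (\<zeta> i)) t n - vertex_term z (S (\<zeta>' i)) t n)))"
    by (simp add: fun_eq_iff vertex_term_def pd_constraint[OF t] sum_distrib_left algebra_simps)
  moreover have "(\<lambda>n. 1 / 2 * (\<Sum>i=1..N. c i * (vertex_term z (S (\<zeta> i)) t n - vertex_term z (S (\<zeta>' i)) t n))) sums
      (1 / 2 * (\<Sum>i=1..N. c i * (vertex_op z (S (\<zeta> i)) t / 2 - vertex_op z (S (\<zeta>' i)) t / 2)))"
    by (intro sums_mult sums_sum sums_diff sums R(2,3))
  ultimately have "vertex_term z (pd 0 F) t sums
      (1 / 2 * (\<Sum>i=1..N. c i * (vertex_op z (S (\<zeta> i)) t / 2 - vertex_op z (S (\<zeta>' i)) t / 2)))"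
    by metis
  then have "vertex_op z (pd 0 F) t
      = 2 * (1 / 2 * (\<Sum>i=1..N. c i * (vertex_op z (S (\<zeta> i)) t / 2 - vertex_op z (S (\<zeta>' i)) t / 2)))"
    unfolding vertex_op_def[of z "pd 0 F"] by (simp only: sums_unique[symmetric])
  then show ?thesis by (simp add: sum_distrib_left algebra_simps diff_divide_distrib)
qed

abbreviation p where "p t i \<equiv> momentum S (\<zeta> i) t"
abbreviation p' where "p' t i \<equiv> momentum S (\<zeta>' i) t"

text \<open>In \<open>momentum_F\<close> the momentum is \<open>z\<close> minus the vertex series of
  \<open>pd 0 F\<close>. The constraint writes this series as a combination of those of the
  \<open>S (\<zeta> i)\<close> and \<open>S (\<zeta>' i)\<close>, whose differences are, up to sign,
  the logarithms of \<open>ratio2\<close>.\<close>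

lemma sato_relation_momentum:
  assumes t: "t \<in> T"
  shows "sato_relation R N c (p t) (p' t) (\<lambda>z. momentum S z t)"
  unfolding sato_relation_def
proof (intro conjI ballI)
  have "exterior R \<subseteq> exterior 1" using R(1) by (auto simp: exterior_def)
  then show "(\<lambda>z. momentum S z t) holomorphic_on exterior R"
    by (rule holomorphic_on_subset[OF momentum_holomorphic[OF t]])
  show "filterlim (\<lambda>z. momentum S z t) at_infinity at_infinity"
    by (rule momentum_filterlim[OF t])
  show "has_log ((\<lambda>z. momentum S z t) ` exterior R) (ratio2 (p t i) (p' t i))" if "i \<in> {1..N}" for i
    using momentum_log_inf(2)[OF t R(1) R(2,3)[OF that]] .
  fix z assume z: "z \<in> exterior R"
  have "(\<Sum>i=1..N. c i * log_inf ((\<lambda>z. momentum S z t) ` exterior R) (ratio2 (p t i) (p' t i)) (momentum S z t))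
      = (\<Sum>i=1..N. c i * (vertex_op z (S (\<zeta>' i)) t - vertex_op z (S (\<zeta> i)) t))"
    by (rule sum.cong[OF refl]) (simp only: momentum_log_inf(4)[OF t R(1) R(2,3) z])
  also have "\<dots> = - (\<Sum>i=1..N. c i * (vertex_op z (S (\<zeta> i)) t - vertex_op z (S (\<zeta>' i)) t))"
    by (simp add: sum_negf[symmetric] algebra_simps)
  also have "\<dots> = - (2 * vertex_op z (pd 0 F) t)"
    by (simp add: vertex_op_constraint[OF t z])
  finally have "(\<Sum>i=1..N. c i * log_inf ((\<lambda>z. momentum S z t) ` exterior R) (ratio2 (p t i) (p' t i)) (momentum S z t))
      = - (2 * vertex_op z (pd 0 F) t)" .
  moreover have "1 < norm z" using z R(1) by (auto simp: exterior_def)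
  ultimately show "z = momentum S z t - 1 / 2 * (\<Sum>i=1..N. c i *
      log_inf ((\<lambda>z. momentum S z t) ` exterior R) (ratio2 (p t i) (p' t i)) (momentum S z t))"
    using momentum_F(2)[OF t, of z] by simp
qed

text \<open>Near infinity the two logarithms agree, and the Sato relation for the momentum exhibits
  \<open>q \<mapsto> q - 1/2 \<Sum> c ln\<close> as the inverse of the momentum; hence any other solution agrees with
  the momentum near infinity.\<close>

lemma sato_relation_unique:
  assumes t: "t \<in> T" and P: "sato_relation R N c (p t) (p' t) P" and z: "z \<in> exterior R"
  shows "P z = momentum S z t"
proof (rule holomorphic_eq_if_eventually_eq[OF open_exterior connected_exterior _ _ _ z])
  let ?m = "\<lambda>z. momentum S z t"
  let ?L = "\<lambda>Q i. log_inf (Q ` exterior R) (ratio2 (p t i) (p' t i))"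
  note M = sato_relation_momentum[OF t]
  show "P holomorphic_on exterior R" "?m holomorphic_on exterior R"
    using P M by (auto simp: sato_relation_def)
  have "\<forall>\<^sub>F q in at_infinity. ?L P i q = ?L ?m i q" if "i \<in> {1..N}" for i
  proof -
    have "has_log (P ` exterior R) (ratio2 (p t i) (p' t i))" "has_log (?m ` exterior R) (ratio2 (p t i) (p' t i))"
      using P M that unfolding sato_relation_def by blast+
    then show ?thesis by (intro log_branch_eventually_eq[OF log_branch_log_inf log_branch_log_inf])
  qed
  then have "\<forall>\<^sub>F q in at_infinity. \<forall>i\<in>{1..N}. ?L P i q = ?L ?m i q"
    by (intro eventually_ball_finite) auto
  then have ev: "\<forall>\<^sub>F q in at_infinity. (\<forall>i\<in>{1..N}. ?L P i q = ?L ?m i q) \<and> (\<exists>z. R < norm z \<and> q = ?m z)"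
    using momentum_onto_near_infinity[OF t R(1)] by (rule eventually_conj)
  have "filterlim P at_infinity at_infinity" using P by (simp add: sato_relation_def)
  then have "\<forall>\<^sub>F z in at_infinity. (\<forall>i\<in>{1..N}. ?L P i (P z) = ?L ?m i (P z)) \<and> (\<exists>z'. R < norm z' \<and> P z = ?m z')"
    by (rule eventually_compose_filterlim[OF ev])
  then show "\<forall>\<^sub>F z in at_infinity. z \<in> exterior R \<and> P z = ?m z"
    using eventually_in_exterior[of R]
  proof eventually_elim
    case (elim z)
    then obtain z' where z': "z' \<in> exterior R" "P z = ?m z'" by (auto simp: exterior_def)
    have "z = P z - 1 / 2 * (\<Sum>i=1..N. c i * ?L P i (P z))"
      using P elim unfolding sato_relation_def by blast
    also have "\<dots> = ?m z' - 1 / 2 * (\<Sum>i=1..N. c i * ?L ?m i (?m z'))"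
      using elim z' by simp
    also have "\<dots> = z'"
      using M z'(1) unfolding sato_relation_def by force
    finally show ?case using elim z' by simp
  qed
qed

text \<open>The momentum witnesses existence and \<open>sato_relation_unique\<close> makes the
  choice irrelevant on \<open>exterior R\<close>.\<close>

lemma sato_p_momentum:
  assumes "t \<in> T" "z \<in> exterior R"
  shows "sato_p R N c (p t) (p' t) z = momentum S z t"
  by (rule sato_relation_unique[OF assms(1) _ assms(2)])
    (unfold sato_p_def, rule someI[of "sato_relation R N c (p t) (p' t)"], rule sato_relation_momentum[OF assms(1)])

lemma sato_p_image:
  assumes "t \<in> T"
  shows "sato_p R N c (p t) (p' t) ` exterior R = (\<lambda>z. momentum S z t) ` exterior R"
  using sato_p_momentum[OF assms] by (rule image_cong[OF refl])

section \<open>The generating equations\<close>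

text \<open>For all times in \<open>T\<close> the logarithm is
  \<open>- vertex_op z (S \<xi>) t\<close>, so its x-derivative follows from termwise
  differentiation of the vertex series.\<close>

lemma generating_equation1:
  assumes t: "t \<in> T" and \<xi>: "norm \<xi> \<le> R" and z: "z \<in> exterior R"
  shows "vertex_op z (momentum S \<xi>) t = - pd 0 (\<lambda>t. log_inf (sato_p R N c (p t) (p' t) ` exterior R)
    (ratio1 (momentum S \<xi> t)) (sato_p R N c (p t) (p' t) z)) t"
proof -
  have "pd 0 (\<lambda>t. log_inf (sato_p R N c (p t) (p' t) ` exterior R)
      (ratio1 (momentum S \<xi> t)) (sato_p R N c (p t) (p' t) z)) t = pd 0 (\<lambda>t. - vertex_op z (S \<xi>) t) t"
    by (rule pd_cong[OF times_open t])
      (simp only: sato_p_image sato_p_momentum[OF _ z] momentum_log_inf(3)[OF _ R(1) \<xi> \<xi> z])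
  also have "\<dots> = - vertex_op z (momentum S \<xi>) t"
    unfolding pd_def[of 0 "\<lambda>t. - vertex_op z (S \<xi>) t"]
    by (intro DERIV_imp_deriv DERIV_minus vertex_op_S_derivative(2)[OF t R(1) \<xi>])
      (use z in \<open>simp add: exterior_def\<close>)
  finally show ?thesis by simp
qed

text \<open>The logarithm of \<open>ratio2\<close> is the difference of the \<open>ratio1\<close>
  logarithms of the two points, so its x-derivative with the factor \<open>1 / 2\<close> corresponds
  to half the difference of the two momenta.\<close>

lemma generating_equation2:
  assumes t: "t \<in> T" and \<xi>: "norm \<xi> \<le> R" "norm \<xi>' \<le> R" and z: "z \<in> exterior R"
  shows "vertex_op z (\<lambda>t. (momentum S \<xi> t - momentum S \<xi>' t) / 2) t
    = - 1 / 2 * pd 0 (\<lambda>t. log_inf (sato_p R N c (p t) (p' t) ` exterior R)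
        (ratio2 (momentum S \<xi> t) (momentum S \<xi>' t)) (sato_p R N c (p t) (p' t) z)) t"
proof -
  have zR: "R < norm z" using z by (simp add: exterior_def)
  note d = vertex_op_S_derivative[OF t R(1) \<xi>(1) zR] and d' = vertex_op_S_derivative[OF t R(1) \<xi>(2) zR]
  have "pd 0 (\<lambda>t. log_inf (sato_p R N c (p t) (p' t) ` exterior R)
      (ratio2 (momentum S \<xi> t) (momentum S \<xi>' t)) (sato_p R N c (p t) (p' t) z)) t
      = pd 0 (\<lambda>t. vertex_op z (S \<xi>') t - vertex_op z (S \<xi>) t) t"
    by (rule pd_cong[OF times_open t])
      (simp only: sato_p_image sato_p_momentum[OF _ z] momentum_log_inf(4)[OF _ R(1) \<xi> z])
  also have "\<dots> = vertex_op z (momentum S \<xi>') t - vertex_op z (momentum S \<xi>) t"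
    unfolding pd_def[of 0 "\<lambda>t. vertex_op z (S \<xi>') t - vertex_op z (S \<xi>) t"]
    by (intro DERIV_imp_deriv DERIV_diff d(2) d'(2))
  finally have rhs: "- 1 / 2 * pd 0 (\<lambda>t. log_inf (sato_p R N c (p t) (p' t) ` exterior R)
      (ratio2 (momentum S \<xi> t) (momentum S \<xi>' t)) (sato_p R N c (p t) (p' t) z)) t
      = (vertex_op z (momentum S \<xi>) t - vertex_op z (momentum S \<xi>') t) / 2"
    by (simp add: field_simps)
  have "pd n (\<lambda>t. (momentum S \<xi> t - momentum S \<xi>' t) / 2) t
      = (pd n (momentum S \<xi>) t - pd n (momentum S \<xi>') t) / 2" for n
    unfolding pd_def
    by (intro DERIV_imp_deriv DERIV_cdivide DERIV_diff field_differentiable_derivI momentum_differentiable t)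
  then have "vertex_term z (\<lambda>t. (momentum S \<xi> t - momentum S \<xi>' t) / 2) t
      = (\<lambda>n. (vertex_term z (momentum S \<xi>) t n - vertex_term z (momentum S \<xi>') t n) / 2)"
    by (simp only: fun_eq_iff vertex_term_def right_diff_distrib times_divide_eq_right) simp
  then have "vertex_op z (\<lambda>t. (momentum S \<xi> t - momentum S \<xi>' t) / 2) t
      = (vertex_op z (momentum S \<xi>) t - vertex_op z (momentum S \<xi>') t) / 2"
    using d(1) d'(1) unfolding vertex_op_def vertex_summable_def
    by (simp add: suminf_divide[OF summable_diff] suminf_diff[symmetric])
  then show ?thesis by (rule trans[OF _ rhs[symmetric]])
qed

end

section \<open>The properties of the constrained hierarchy\<close>

theorem mainTheorem9:
  fixes T :: "times set"
    and W :: "complex \<Rightarrow> complex \<Rightarrow> complex \<Rightarrow> complex"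
    and S :: "complex \<Rightarrow> times \<Rightarrow> complex"
    and Sc :: "nat \<Rightarrow> times \<Rightarrow> complex"
    and F u :: "times \<Rightarrow> complex"
    and N :: nat
    and c \<zeta> \<zeta>' :: "nat \<Rightarrow> complex"
    and p p' :: "nat \<Rightarrow> times \<Rightarrow> complex"
    and R :: real
    and P :: "times \<Rightarrow> complex \<Rightarrow> complex"
    and \<Omega> :: "times \<Rightarrow> complex set"
  assumes solution: "dBKP_solution T W S Sc"
    and tau: "tau_function T S F"
    and u_def: "u = (\<lambda>t. - pd 0 (Sc 1) t)"
    and p_def: "p = (\<lambda>k. momentum S (\<zeta> k))"
    and p'_def: "p' = (\<lambda>k. momentum S (\<zeta>' k))"
    and constraint:
      "\<forall>t\<in>T. pd 0 F t = 1 / 2 * (\<Sum>i=1..N. c i * (S (\<zeta> i) t - S (\<zeta>' i) t))"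
    and R_def: "R = sato_radius N \<zeta> \<zeta>'"
    and P_def: "P = (\<lambda>t. sato_p R N c (\<lambda>i. p i t) (\<lambda>i. p' i t))"
    and Omega_def: "\<Omega> = (\<lambda>t. P t ` exterior R)"
  shows
    "(\<forall>t\<in>T. u t = (\<Sum>i=1..N. c i * (p i t - p' i t)))
     \<and>
     (\<forall>t\<in>T. \<forall>k\<in>{1..N}.
        pd 1 (p k) t
          = pd 0 (\<lambda>t. p k t ^ 3 + 3 * p k t * (\<Sum>i=1..N. c i * (p i t - p' i t))) t \<and>
        pd 1 (p' k) t
          = pd 0 (\<lambda>t. p' k t ^ 3 + 3 * p' k t * (\<Sum>i=1..N. c i * (p i t - p' i t))) t)
     \<and>
     (\<forall>t\<in>T. sato_relation R N c (\<lambda>i. p i t) (\<lambda>i. p' i t) (\<lambda>z. momentum S z t))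
     \<and>
     (\<forall>t\<in>T. \<forall>k\<in>{1..N}.
        has_log (\<Omega> t) (ratio1 (p k t)) \<and>
        has_log (\<Omega> t) (ratio1 (p' k t)) \<and>
        has_log (\<Omega> t) (ratio2 (p k t) (p' k t)) \<and>
        (\<forall>z\<in>exterior R.
           vertex_summable z (p k) t \<and>
           vertex_op z (p k) t
             = - pd 0 (\<lambda>t. log_inf (\<Omega> t) (ratio1 (p k t)) (P t z)) t \<and>
           vertex_summable z (p' k) t \<and>
           vertex_op z (p' k) t
             = - pd 0 (\<lambda>t. log_inf (\<Omega> t) (ratio1 (p' k t)) (P t z)) t \<and>
           vertex_op z (\<lambda>t. (p k t - p' k t) / 2) t
             = - 1 / 2 * pd 0 (\<lambda>t. log_inf (\<Omega> t) (ratio2 (p k t) (p' k t)) (P t z)) t))"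
proof -
  interpret D: dBKP_solution T W S Sc by (rule solution)
  interpret D: dBKP_constrained T W S Sc F N c \<zeta> \<zeta>'
    by unfold_locales (use tau constraint in auto)
  have R: "R = D.R" by (simp add: R_def D.R_def)
  show ?thesis
    unfolding Omega_def P_def p_def p'_def u_def R
  proof (intro conjI ballI)
    fix t assume t: "t \<in> T"
    show "- pd 0 (Sc 1) t = (\<Sum>i=1..N. c i * (momentum S (\<zeta> i) t - momentum S (\<zeta>' i) t))"
      by (simp only: D.pd_Sc_1[OF t] D.constraint_u[OF t])
    show "sato_relation D.R N c (D.p t) (D.p' t) (\<lambda>z. momentum S z t)"
      by (rule D.sato_relation_momentum[OF t])
    fix k assume k: "k \<in> {1..N}"
    note le = D.R(2,3)[OF k]
    show "has_log (sato_p D.R N c (D.p t) (D.p' t) ` exterior D.R) (ratio1 (momentum S (\<zeta> k) t))"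
      "has_log (sato_p D.R N c (D.p t) (D.p' t) ` exterior D.R) (ratio1 (momentum S (\<zeta>' k) t))"
      "has_log (sato_p D.R N c (D.p t) (D.p' t) ` exterior D.R)
        (ratio2 (momentum S (\<zeta> k) t) (momentum S (\<zeta>' k) t))"
      unfolding D.sato_p_image[OF t] by (rule D.momentum_log_inf[OF t D.R(1)] le)+
    fix z assume z: "z \<in> exterior D.R"
    then have zR: "D.R < norm z" by (simp add: exterior_def)
    show "vertex_summable z (momentum S (\<zeta> k)) t" "vertex_summable z (momentum S (\<zeta>' k)) t"
      by (rule D.vertex_op_S_derivative(1)[OF t D.R(1) _ zR] le)+
  qed (rule D.first_flow D.generating_equation1 D.generating_equation2 D.R(2,3) | assumption)+
qed

end
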